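(* Let $0<\epsilon<1$. Let $\rho^{XYM}$ be a subnormalised density matrix. Let $\alpha^X,\beta^Y$ be normalised density matrices such that $\mathrm{supp}(\rho^X)\subseteq\mathrm{supp}(\alpha^X)$ and $\mathrm{supp}(\rho^Y)\subseteq\mathrm{supp}(\beta^Y)$. Let $A,B$ be positive integers, $\alpha^{X^A}:=(\alpha^X)^{\otimes A}$, $\beta^{Y^B}:=(\beta^Y)^{\otimes B}$, and for $a\in[A]$, $b\in[B]$ let $\alpha^{X^{-a}}$ be the $(A-1)$-fold tensor product of $\alpha^X$ over all the $X$ registers except $X_a$, and $\beta^{Y^{-b}}$ the $(B-1)$-fold tensor product of $\beta^Y$ over all the $Y$ registers except $Y_b$. Define $$\sigma^{X^AY^BM}:=(AB)^{-1}\sum_{a=1}^A\sum_{b=1}^B\rho^{X_aY_bM}\otimes\alpha^{X^{-a}}\otimes\beta^{Y^{-b}},\qquad\tau^{X^AY^BM}:=\alpha^{X^A}\otimes\beta^{Y^B}\otimes\rho^M.$$ Suppose $$\log A>D^\epsilon_\infty(\rho^{XM}\|\alpha^X\otimes\rho^M)+\log\epsilon^{-1/20},$$ $$\log B>D^\epsilon_\infty(\rho^{YM}\|\beta^Y\otimes\rho^M)+\log\epsilon^{-1/20},$$ $$\log A+\log B>D^\epsilon_\infty(\rho^{XYM}\|\alpha^X\otimes\beta^Y\otimes\rho^M)+\log\epsilon^{-1/20}.$$ Then $\|\sigma^{X^AY^BM}-\tau^{X^AY^BM}\|_1<10\,\epsilon^{1/64}(\mathrm{Tr}\,\rho)$.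
   Context: Hilbert spaces are finite dimensional; $\log$ is base 2. A subnormalised (normalised) density matrix is a positive semidefinite matrix of trace at most (exactly) one. $X^A=X_1\otimes\cdots\otimes X_A$ with each $X_a\cong X$, similarly $Y^B$; $\rho^{X_aY_bM}$ is a copy of $\rho^{XYM}$ on registers $X_a,Y_b,M$. Marginals are denoted by superscripts. For a subnormalised density matrix $\alpha$ and positive semidefinite $\beta$: $D_\infty(\alpha\|\beta):=\log\|\beta^{-1/2}\alpha\beta^{-1/2}\|_\infty$ (pseudoinverse) if $\mathrm{supp}(\alpha)\subseteq\mathrm{supp}(\beta)$, $+\infty$ otherwise. $D^\epsilon_\infty(\alpha\|\beta):=\min_{\alpha'}D_\infty(\alpha'\|\beta)$ over subnormalised density matrices $\alpha'$ with $\|\alpha'-\alpha\|_1\leq\epsilon(\mathrm{Tr}\,\alpha)$. *)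

theory Defs
  imports "HOL-Analysis.Analysis"
begin

text \<open>
  Operators on a finite dimensional Hilbert space with orthonormal basis indexed by a finite
  type are square complex matrices over that type.  The system composed of registers with basis
  types \<^typ>\<open>'m\<close> and \<^typ>\<open>'n\<close> has basis type \<^typ>\<open>'m \<times> 'n\<close>; the system made of one copy of a
  register with basis type \<^typ>\<open>'x\<close> for each element of a finite type \<^typ>\<open>'a\<close> has basis type
  \<^typ>\<open>'a \<Rightarrow> 'x\<close>.
\<close>

type_synonym 'n cmat = "complex ^ 'n ^ 'n"

definition cdot :: "complex ^ 'n \<Rightarrow> complex ^ 'n \<Rightarrow> complex" where
  "cdot u v = (\<Sum>i\<in>UNIV. cnj (u $ i) * v $ i)"

definition adj :: "('n::finite) cmat \<Rightarrow> 'n cmat" where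
  "adj P = (\<chi> i j. cnj (P $ j $ i))"

text \<open>Over the complex numbers, a nonnegative quadratic form already makes the matrix Hermitian.\<close>

definition psd :: "('n::finite) cmat \<Rightarrow> bool" where
  "psd P \<longleftrightarrow> (\<forall>v. cdot v (P *v v) \<in> \<real>\<^sub>\<ge>\<^sub>0)"

definition subnormalised :: "('n::finite) cmat \<Rightarrow> bool" where
  "subnormalised P \<longleftrightarrow> psd P \<and> Re (trace P) \<le> 1"

definition normalised :: "('n::finite) cmat \<Rightarrow> bool" where
  "normalised P \<longleftrightarrow> psd P \<and> trace P = 1"

definition supp :: "('n::finite) cmat \<Rightarrow> (complex ^ 'n) set" where
  "supp P = {v. \<forall>w. P *v w = 0 \<longrightarrow> cdot w v = 0}"

definition msqrt :: "('n::finite) cmat \<Rightarrow> 'n cmat" where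
  "msqrt P = (THE S. psd S \<and> S ** S = P)"

text \<open>The Moore--Penrose pseudoinverse, characterised by the four Penrose equations.\<close>

definition pinv :: "('n::finite) cmat \<Rightarrow> 'n cmat" where
  "pinv P = (THE G. P ** G ** P = P \<and> G ** P ** G = G \<and>
                    adj (P ** G) = P ** G \<and> adj (G ** P) = G ** P)"

definition trace_norm :: "('n::finite) cmat \<Rightarrow> real" where
  "trace_norm P = Re (trace (msqrt (adj P ** P)))"

definition tensor :: "('m::finite) cmat \<Rightarrow> ('n::finite) cmat \<Rightarrow> ('m \<times> 'n) cmat"
    (infixr "\<otimes>\<^sub>t" 75) where
  "P \<otimes>\<^sub>t Q = (\<chi> i j. P $ fst i $ fst j * Q $ snd i $ snd j)"

text \<open>
  The entry at row \<open>f\<close> and column \<open>g\<close> of the tensor product of copies of \<open>P\<close>, one for each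
  register in \<open>S\<close>; it depends only on the values of \<open>f\<close> and \<open>g\<close> on \<open>S\<close>.
\<close>

definition tensor_entry ::
    "'a set \<Rightarrow> ('x::finite) cmat \<Rightarrow> ('a \<Rightarrow> 'x) \<Rightarrow> ('a \<Rightarrow> 'x) \<Rightarrow> complex" where
  "tensor_entry S P f g = (\<Prod>s\<in>S. P $ f s $ g s)"

definition tensor_power :: "('x::finite) cmat \<Rightarrow> ('a::finite \<Rightarrow> 'x) cmat" where
  "tensor_power P = (\<chi> f g. tensor_entry UNIV P f g)"

definition marg_X :: "('x::finite \<times> 'y::finite \<times> 'm::finite) cmat \<Rightarrow> 'x cmat" where
  "marg_X P = (\<chi> x x'. \<Sum>y\<in>UNIV. \<Sum>m\<in>UNIV. P $ (x, y, m) $ (x', y, m))"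

definition marg_Y :: "('x::finite \<times> 'y::finite \<times> 'm::finite) cmat \<Rightarrow> 'y cmat" where
  "marg_Y P = (\<chi> y y'. \<Sum>x\<in>UNIV. \<Sum>m\<in>UNIV. P $ (x, y, m) $ (x, y', m))"

definition marg_M :: "('x::finite \<times> 'y::finite \<times> 'm::finite) cmat \<Rightarrow> 'm cmat" where
  "marg_M P = (\<chi> m m'. \<Sum>x\<in>UNIV. \<Sum>y\<in>UNIV. P $ (x, y, m) $ (x, y, m'))"

definition marg_XM :: "('x::finite \<times> 'y::finite \<times> 'm::finite) cmat \<Rightarrow> ('x \<times> 'm) cmat" where
  "marg_XM P = (\<chi> i j. \<Sum>y\<in>UNIV. P $ (fst i, y, snd i) $ (fst j, y, snd j))"

definition marg_YM :: "('x::finite \<times> 'y::finite \<times> 'm::finite) cmat \<Rightarrow> ('y \<times> 'm) cmat" where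
  "marg_YM P = (\<chi> i j. \<Sum>x\<in>UNIV. P $ (x, fst i, snd i) $ (x, fst j, snd j))"

text \<open>
  The library's \<^term>\<open>log 2 0\<close> is \<open>0\<close>, so the value \<open>-\<infinity>\<close> at the zero matrix is spelled out.
\<close>

definition D_inf :: "('n::finite) cmat \<Rightarrow> 'n cmat \<Rightarrow> ereal" where
  "D_inf P Q =
     (if supp P \<subseteq> supp Q then
        (let r = onorm ((*v) (pinv (msqrt Q) ** P ** pinv (msqrt Q)))
         in if r = 0 then -\<infinity> else ereal (log 2 r))
      else \<infinity>)"

text \<open>
  The infimum is attained: the smoothing ball is compact, and where \<open>D_inf\<close> is finite it is
  continuous on the closed set of operators supported in \<open>supp Q\<close>.
\<close>

definition D_inf_smooth :: "real \<Rightarrow> ('n::finite) cmat \<Rightarrow> 'n cmat \<Rightarrow> ereal" where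
  "D_inf_smooth e P Q =
     (INF P' \<in> {P'. subnormalised P' \<and> trace_norm (P' - P) \<le> e * Re (trace P)}. D_inf P' Q)"

text \<open>
  \<open>rho\<close> on the registers \<open>X\<^sub>a\<close>, \<open>Y\<^sub>b\<close>, \<open>M\<close>, tensored with \<open>alpha\<close> on every other \<open>X\<close> register
  and with \<open>beta\<close> on every other \<open>Y\<close> register.
\<close>

definition placed ::
    "('x::finite) cmat \<Rightarrow> ('y::finite) cmat \<Rightarrow> ('x \<times> 'y \<times> 'm::finite) cmat \<Rightarrow>
     'a::finite \<Rightarrow> 'b::finite \<Rightarrow> (('a \<Rightarrow> 'x) \<times> ('b \<Rightarrow> 'y) \<times> 'm) cmat" where
  "placed alpha beta rho a b =
     (\<chi> i j. case (i, j) of ((f, g, m), (f', g', m')) \<Rightarrow>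
        rho $ (f a, g b, m) $ (f' a, g' b, m') *
        tensor_entry (UNIV - {a}) alpha f f' *
        tensor_entry (UNIV - {b}) beta g g')"

end

theory Submission
  imports Defs
begin

text \<open>
  Write \<open>w = alpha \<otimes> beta \<otimes> mu\<close> with \<open>mu\<close> the marginal of \<open>rho\<close> on \<open>M\<close>, and let \<open>E\<^sub>X\<close> (\<open>E\<^sub>Y\<close>) replace the
  \<open>X\<close> (\<open>Y\<close>) part of an operator by \<open>alpha\<close> (\<open>beta\<close>).  Telescoping gives
  \<open>rho - w = (1 - E\<^sub>X) (1 - E\<^sub>Y) rho + (1 - E\<^sub>X) (E\<^sub>Y rho) + (1 - E\<^sub>Y) (E\<^sub>X rho)\<close>.
  In the three terms, \<open>rho\<close> and its two marginals may be replaced by their own smoothings, even though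
  these are unrelated to each other, at a cost of at most \<open>(4 + 2 + 2) eps\<close> in trace norm, since
  \<open>E\<^sub>X\<close> and \<open>E\<^sub>Y\<close> contract the trace norm.  Afterwards the copies of a
  term placed on different registers are orthogonal for \<open>(S, T) \<mapsto> Tr (S\<^sup>* w\<^sup>-\<^sup>1 T)\<close>, so averaging over
  \<open>n\<close> copies divides the weighted second moment by \<open>n\<close>; \<open>1 - E\<^sub>X\<close> and \<open>1 - E\<^sub>Y\<close> are
  orthogonal projections, so centring does not increase it; and \<open>R \<le> r w\<close> bounds it by \<open>r Tr R\<close>.
  By the Cauchy--Schwarz inequality the square root of the weighted second moment controls the trace norm.
  When \<open>eps powr (1/64) > 1/5\<close> the claimed bound exceeds the trivial bound \<open>2 Tr rho\<close>.
\<close>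

subsection \<open>Adjoints and the Hilbert--Schmidt inner product\<close>

lemma adj_adj [simp]: "adj (adj P) = P"
  by (simp add: adj_def vec_eq_iff)

lemma adj_mult: "adj (P ** Q) = adj Q ** adj P"
  by (simp add: adj_def matrix_matrix_mult_def vec_eq_iff cnj_sum mult.commute)

lemma adj_add: "adj (P + Q) = adj P + adj Q"
  by (simp add: adj_def vec_eq_iff)

lemma adj_diff: "adj (P - Q) = adj P - adj Q"
  by (simp add: adj_def vec_eq_iff)

lemma adj_scaleR: "adj (c *\<^sub>R P) = c *\<^sub>R adj P"
  by (simp add: adj_def vec_eq_iff)

lemma adj_sum: "adj (\<Sum>i\<in>I. F i) = (\<Sum>i\<in>I. adj (F i))"
  by (induction I rule: infinite_finite_induct) (simp_all add: adj_add, simp_all add: adj_def vec_eq_iff)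

lemma adj_mat_1 [simp]: "adj (mat 1) = mat 1"
  by (simp add: adj_def mat_def vec_eq_iff)

lemma trace_adj: "trace (adj P) = cnj (trace P)"
  by (simp add: trace_def adj_def)

lemma trace_scaleR: "trace (c *\<^sub>R P) = c *\<^sub>R trace (P :: ('n::finite) cmat)"
  by (simp add: trace_def scaleR_sum_right)

lemma trace_sum: "trace (\<Sum>i\<in>I. F i) = (\<Sum>i\<in>I. trace (F i :: ('n::finite) cmat))"
  by (simp add: trace_def) (rule sum.swap)

lemma matrix_diff_ldistrib: "(P :: ('n::finite) cmat) ** (Q - R) = P ** Q - P ** R"
  by (simp add: matrix_matrix_mult_def vec_eq_iff right_diff_distrib sum_subtractf)

lemma matrix_diff_rdistrib: "(Q - R) ** (P :: ('n::finite) cmat) = Q ** P - R ** P"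
  by (simp add: matrix_matrix_mult_def vec_eq_iff left_diff_distrib sum_subtractf)

lemma matrix_sum_ldistrib: "(P :: ('n::finite) cmat) ** (\<Sum>i\<in>I. F i) = (\<Sum>i\<in>I. P ** F i)"
  by (simp add: matrix_matrix_mult_def vec_eq_iff sum_distrib_left) (auto intro: sum.swap)

lemma matrix_sum_rdistrib: "(\<Sum>i\<in>I. F i) ** (P :: ('n::finite) cmat) = (\<Sum>i\<in>I. F i ** P)"
  by (simp add: matrix_matrix_mult_def vec_eq_iff sum_distrib_right) (auto intro: sum.swap)

lemma scaleR_mult_left: "(c *\<^sub>R P) ** Q = c *\<^sub>R (P ** (Q :: ('n::finite) cmat))"
  by (rule scalar_matrix_assoc [symmetric])

lemma scaleR_mult_right: "P ** (c *\<^sub>R Q) = c *\<^sub>R (P ** (Q :: ('n::finite) cmat))"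
  by (simp add: matrix_matrix_mult_def vec_eq_iff scaleR_sum_right)

lemma matrix_vector_diff_rdistrib: "(P - Q) *v v = P *v v - (Q :: ('n::finite) cmat) *v v"
  by (simp add: matrix_vector_mult_def vec_eq_iff left_diff_distrib sum_subtractf)

lemma cdot_adj: "cdot u (P *v v) = cdot (adj P *v u) v"
  unfolding cdot_def adj_def matrix_vector_mult_def
  by (simp add: sum_distrib_left sum_distrib_right cnj_sum mult.assoc mult.left_commute)
     (rule sum.swap)

lemma cdot_add_right: "cdot u (v + w) = cdot u v + cdot u w"
  by (simp add: cdot_def distrib_left sum.distrib)

lemma cdot_diff_right: "cdot u (v - w) = cdot u v - cdot u w"
  by (simp add: cdot_def right_diff_distrib sum_subtractf)

lemma cdot_scaleR_right: "cdot u (c *\<^sub>R v) = c *\<^sub>R cdot u v"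
  by (simp add: cdot_def scaleR_sum_right)

lemma cdot_cnj: "cnj (cdot u v) = cdot v u"
  by (simp add: cdot_def cnj_sum mult.commute)

lemma inner_eq_Re_cdot: "inner u v = Re (cdot u v)"
  by (simp add: inner_vec_def cdot_def inner_complex_def)

lemma cdot_self: "cdot u u = of_real ((norm u)\<^sup>2)"
proof (rule complex_eqI)
  show "Re (cdot u u) = Re (of_real ((norm u)\<^sup>2))"
    by (simp add: inner_eq_Re_cdot [symmetric] power2_norm_eq_inner)
  have "Im (cdot u u) = - Im (cdot u u)"
    using cdot_cnj [of u u] by (metis cnj.simps(2))
  then show "Im (cdot u u) = Im (of_real ((norm u)\<^sup>2))"
    by simp
qed

lemma inner_eq_Re_trace: "inner P Q = Re (trace (adj P ** Q))"
proof -
  have "inner P Q = (\<Sum>i\<in>UNIV. \<Sum>j\<in>UNIV. Re (cnj (P $ i $ j) * Q $ i $ j))"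
    by (simp add: inner_vec_def inner_complex_def)
  also have "\<dots> = (\<Sum>j\<in>UNIV. \<Sum>i\<in>UNIV. Re (cnj (P $ i $ j) * Q $ i $ j))"
    by (rule sum.swap)
  finally show ?thesis
    by (simp add: trace_def adj_def matrix_matrix_mult_def)
qed

subsection \<open>Positive semidefinite matrices\<close>

text \<open>Polarisation: the quadratic form is evaluated at \<open>e_i + c e_j\<close> for standard
  basis vectors. That it is real for \<open>c = 1\<close> and \<open>c = \<i>\<close> ties the
  imaginary and the real parts of the two opposite entries together.\<close>

lemma psd_hermitian:
  assumes "psd P"
  shows "adj P = P"
proof -
  have "cnj (P $ j $ i) = P $ i $ j" for i j
  proof -
    have *: "Im (cdot (\<chi> k. (if k = i then 1 else 0) + (if k = j then c else 0))
        (P *v (\<chi> k. (if k = i then 1 else 0) + (if k = j then c else 0)))) = 0" for c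
      using assms complex_nonneg_Reals_iff unfolding psd_def by blast
    have d: "Im (P $ k $ k) = 0" for k
    proof -
      have "Im (cdot (axis k 1) (P *v axis k 1)) = 0"
        using assms complex_nonneg_Reals_iff unfolding psd_def by blast
      then show ?thesis
        by (simp add: cdot_def axis_def matrix_vector_mult_def if_distrib [where f = cnj] if_distrib [where f = "\<lambda>x. _ * x"]
            if_distrib [where f = "\<lambda>x. x * _"] cong: if_cong)
    qed
    have e: "cdot (\<chi> k. (if k = i then 1 else 0) + (if k = j then c else 0))
        (P *v (\<chi> k. (if k = i then 1 else 0) + (if k = j then c else 0)))
        = P $ i $ i + c * P $ i $ j + cnj c * P $ j $ i + cnj c * c * P $ j $ j" for c
      by (simp add: cdot_def matrix_vector_mult_def algebra_simps sum.distrib if_distrib [where f = cnj] if_distrib [where f = "\<lambda>x. _ * x"]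
            if_distrib [where f = "\<lambda>x. x * _"] cong: if_cong)
    show ?thesis
      using * [of 1] * [of \<i>] d [of i] d [of j] unfolding e
      by (simp add: complex_eq_iff)
  qed
  then show ?thesis
    by (simp add: adj_def vec_eq_iff)
qed

lemma psd_iff: "psd P \<longleftrightarrow> adj P = P \<and> (\<forall>v. 0 \<le> Re (cdot v (P *v v)))"
proof
  assume "psd P"
  then show "adj P = P \<and> (\<forall>v. 0 \<le> Re (cdot v (P *v v)))"
    using psd_hermitian by (auto simp: psd_def complex_nonneg_Reals_iff)
next
  assume *: "adj P = P \<and> (\<forall>v. 0 \<le> Re (cdot v (P *v v)))"
  have "Im (cdot v (P *v v)) = 0" for v
  proof -
    have "cnj (cdot v (P *v v)) = cdot v (P *v v)"
      using * by (simp add: cdot_cnj) (metis cdot_adj)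
    then show ?thesis
      by (metis Reals_cnj_iff complex_is_Real_iff)
  qed
  with * show "psd P"
    by (simp add: psd_def complex_nonneg_Reals_iff)
qed

lemma psd_0 [simp]: "psd 0"
  by (simp add: psd_def cdot_def)

lemma psd_add: "psd P \<Longrightarrow> psd Q \<Longrightarrow> psd (P + Q)"
  by (simp add: psd_iff adj_add matrix_vector_mult_add_rdistrib cdot_add_right)

lemma psd_sum: "(\<And>i. i \<in> I \<Longrightarrow> psd (F i)) \<Longrightarrow> psd (\<Sum>i\<in>I. F i)"
  by (induction I rule: infinite_finite_induct) (auto intro: psd_add)

lemma scaleR_mult_vector: "(c *\<^sub>R P) *v v = c *\<^sub>R ((P :: ('n::finite) cmat) *v v)"
  by (simp add: matrix_vector_mult_def vec_eq_iff scaleR_sum_right)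

lemma mult_scaleR_vector: "(P :: ('n::finite) cmat) *v (c *\<^sub>R v) = c *\<^sub>R (P *v v)"
  by (simp add: matrix_vector_mult_def vec_eq_iff scaleR_sum_right)

lemma psd_scaleR: "psd P \<Longrightarrow> 0 \<le> c \<Longrightarrow> psd (c *\<^sub>R P)"
  by (simp add: psd_iff adj_scaleR scaleR_mult_vector cdot_scaleR_right)

lemma psd_adj_mult: "psd (adj P ** P)"
  by (simp add: psd_iff adj_mult matrix_vector_mul_assoc [symmetric] cdot_adj [of _ "adj P"] cdot_self)

lemma psd_conjugate:
  assumes "psd P"
  shows "psd (adj Q ** P ** Q)"
proof -
  have "cdot v ((adj Q ** P ** Q) *v v) = cdot (Q *v v) (P *v (Q *v v))" for v
    by (simp add: matrix_vector_mul_assoc [symmetric] cdot_adj [of _ "adj Q"])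
  with assms show ?thesis
    by (simp add: psd_def)
qed

lemma psd_diag_nonneg:
  assumes "psd P"
  shows "0 \<le> Re (P $ i $ i)"
proof -
  have "0 \<le> Re (cdot (axis i 1) (P *v axis i 1))"
    using assms by (simp add: psd_iff)
  then show ?thesis
    by (simp add: cdot_def axis_def matrix_vector_mult_def if_distrib [where f = cnj] if_distrib [where f = "\<lambda>x. _ * x"]
            if_distrib [where f = "\<lambda>x. x * _"] cong: if_cong)
qed

lemma psd_trace_nonneg: "psd P \<Longrightarrow> 0 \<le> Re (trace P)"
  by (auto simp: trace_def intro!: sum_nonneg psd_diag_nonneg)

subsection \<open>The spectral theorem\<close>

definition diagm :: "('n::finite \<Rightarrow> real) \<Rightarrow> 'n cmat" where
  "diagm d = (\<chi> i j. if i = j then of_real (d i) else 0)"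

lemma diagm_mult: "diagm d ** diagm e = diagm (\<lambda>i. d i * e i)"
  by (simp add: diagm_def matrix_matrix_mult_def vec_eq_iff if_distrib [where f = "\<lambda>x. x * _"] cong: if_cong)

lemma diagm_vector: "(diagm d *v u) $ i = of_real (d i) * u $ i"
  by (simp add: diagm_def matrix_vector_mult_def if_distrib [where f = "\<lambda>x. x * _"] cong: if_cong)

text \<open>The orthogonality conditions form a square homogeneous system; the index outside
  \<open>S\<close> contributes a zero row, so the system is singular.\<close>

lemma exists_orthogonal_vector:
  fixes v :: "'n::finite \<Rightarrow> complex ^ 'n"
  assumes "i \<notin> S"
  shows "\<exists>w. w \<noteq> 0 \<and> (\<forall>j\<in>S. cdot (v j) w = 0)"
proof -
  define M :: "'n cmat" where "M = (\<chi> j k. if j \<in> S then cnj (v j $ k) else 0)"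
  have "row i M = 0"
    using assms by (simp add: row_def M_def vec_eq_iff)
  then have "det M = 0"
    by (rule det_zero_row)
  then have "\<not> invertible M"
    by (simp add: invertible_det_nz)
  then obtain w where w: "M *v w = 0" "w \<noteq> 0"
    by (metis invertible_left_inverse matrix_left_invertible_ker)
  have "cdot (v j) w = 0" if "j \<in> S" for j
  proof -
    have "(M *v w) $ j = 0"
      using w by simp
    with that show ?thesis
      by (simp add: M_def matrix_vector_mult_def cdot_def)
  qed
  with w show ?thesis
    by blast
qed

text \<open>A maximiser of the Rayleigh quotient on an invariant subspace is an eigenvector.\<close>

lemma hermitian_eigenvector_orthogonal:
  fixes T :: "('n::finite) cmat" and v :: "'n \<Rightarrow> complex ^ 'n"
  assumes T: "adj T = T" and "i \<notin> S"
    and eig: "\<And>j. j \<in> S \<Longrightarrow> T *v v j = of_real (d j) *s v j"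
  shows "\<exists>w l. norm w = 1 \<and> (\<forall>j\<in>S. cdot (v j) w = 0) \<and> T *v w = of_real l *s w"
proof -
  define W where "W = {w. \<forall>j\<in>S. cdot (v j) w = 0}"
  have W_diff: "u - w \<in> W" if "u \<in> W" "w \<in> W" for u w
    using that by (simp add: W_def cdot_diff_right)
  have W_scaleR: "c *\<^sub>R u \<in> W" if "u \<in> W" for c u
    using that by (simp add: W_def cdot_scaleR_right)
  have W_T: "T *v u \<in> W" if "u \<in> W" for u
  proof -
    have "cdot (v j) (T *v u) = 0" if "j \<in> S" for j
    proof -
      have "cdot (v j) (T *v u) = cdot (of_real (d j) *s v j) u"
        using T eig that by (simp add: cdot_adj)
      also have "\<dots> = of_real (d j) * cdot (v j) u"
        by (simp add: cdot_def sum_distrib_left mult.assoc)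
      finally show ?thesis
        using \<open>u \<in> W\<close> that by (simp add: W_def)
    qed
    then show ?thesis
      by (simp add: W_def)
  qed
  define f where "f w = Re (cdot w (T *v w))" for w
  have cont: "continuous_on A f" for A
    unfolding f_def inner_eq_Re_cdot [symmetric]
    by (intro continuous_intros linear_continuous_on matrix_vector_mul_bounded_linear)
  have "closed W"
  proof -
    have "W = (\<Inter>j\<in>S. {w. cdot (v j) w = 0})"
      by (auto simp: W_def)
    moreover have "closed {w. cdot (v j) w = 0}" for j
      unfolding cdot_def by (intro closed_Collect_eq continuous_intros)
    ultimately show ?thesis
      by auto
  qed
  then have "compact (W \<inter> sphere 0 1)"
    by (intro closed_Int_compact) auto
  moreover have "W \<inter> sphere 0 1 \<noteq> {}"
  proof -
    obtain w where "w \<noteq> 0" "w \<in> W"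
      using exists_orthogonal_vector [OF \<open>i \<notin> S\<close>, of v] by (auto simp: W_def)
    then have "inverse (norm w) *\<^sub>R w \<in> W \<inter> sphere 0 1"
      using W_scaleR by simp
    then show ?thesis
      by blast
  qed
  ultimately obtain w where "w \<in> W \<inter> sphere 0 1" and sup: "\<forall>u\<in>W \<inter> sphere 0 1. f u \<le> f w"
    using continuous_attains_sup [OF _ _ cont, of "W \<inter> sphere 0 1"] by blast
  then have w: "w \<in> W" "norm w = 1"
    by auto
  have max: "f u \<le> f w" if "u \<in> W" "norm u = 1" for u
    using sup that by simp
  define l where "l = f w"
  \<comment> \<open>The form \<open>inner u (g u)\<close> is nonnegative on \<open>W\<close> and
    vanishes at \<open>w\<close>, so its first variation at \<open>w\<close> vanishes too; varying
    in the direction \<open>g w\<close> forces \<open>g w = 0\<close>.\<close>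
  define g where "g u = l *\<^sub>R u - T *v u" for u
  have g_W: "g u \<in> W" if "u \<in> W" for u
    using that by (simp add: g_def W_diff W_scaleR W_T)
  have g_lin: "g (a - c *\<^sub>R b) = g a - c *\<^sub>R g b" for a b c
    by (simp add: g_def algebra_simps matrix_vector_mult_diff_distrib mult_scaleR_vector)
  have g_sym: "inner a (g b) = inner (g a) b" for a b
    using T by (simp add: g_def inner_diff_left inner_diff_right)
      (simp add: inner_eq_Re_cdot cdot_adj)
  have g_nonneg: "0 \<le> inner u (g u)" if "u \<in> W" for u
  proof (cases "u = 0")
    case False
    have "f (inverse (norm u) *\<^sub>R u) \<le> l"
      using that False max W_scaleR by (simp add: l_def)
    also have "f (inverse (norm u) *\<^sub>R u) = (inverse (norm u))\<^sup>2 * f u"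
      by (simp add: f_def inner_eq_Re_cdot [symmetric] mult_scaleR_vector power2_eq_square)
    finally have "f u \<le> l * (norm u)\<^sup>2"
      using False by (simp add: divide_simps)
    then show ?thesis
      by (simp add: g_def f_def inner_diff_right power2_norm_eq_inner inner_eq_Re_cdot [symmetric])
  qed simp
  have g0: "inner w (g w) = 0"
    using w by (simp add: g_def inner_diff_right l_def f_def inner_eq_Re_cdot [symmetric]
        power2_norm_eq_inner [symmetric])
  have "g w = 0"
  proof (rule ccontr)
    assume "g w \<noteq> 0"
    define z where "z = g w"
    define q where "q = inner z (g z)"
    have "0 < (norm z)\<^sup>2"
      using \<open>g w \<noteq> 0\<close> by (simp add: z_def)
    have "q \<ge> 0"
      using g_nonneg g_W w by (simp add: q_def z_def)
    have *: "0 \<le> c\<^sup>2 * q - 2 * c * (norm z)\<^sup>2" for c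
    proof -
      have "0 \<le> inner (w - c *\<^sub>R z) (g (w - c *\<^sub>R z))"
        using g_nonneg g_W W_diff W_scaleR w by (simp add: z_def)
      also have "\<dots> = c\<^sup>2 * q - 2 * c * (norm z)\<^sup>2"
        using g0 g_sym [of w z]
        by (simp add: g_lin inner_diff_left inner_diff_right q_def z_def [symmetric] power2_norm_eq_inner)
          (simp add: power2_eq_square algebra_simps)
      finally show ?thesis .
    qed
    show False
    proof (cases "q = 0")
      case True
      with * [of 1] \<open>0 < (norm z)\<^sup>2\<close> show False by simp
    next
      case False
      with \<open>q \<ge> 0\<close> have "0 < q" by simp
      define n where "n = (norm z)\<^sup>2"
      \<comment> \<open>The choice \<open>c = n / q\<close> minimises \<open>c^2 q - 2 c n\<close>,
        and the minimum is negative.\<close>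
      have "0 \<le> (n / q)\<^sup>2 * q - 2 * (n / q) * n"
        unfolding n_def by (rule *)
      also have "\<dots> = - (n * n / q)"
        using \<open>0 < q\<close> by (simp add: power2_eq_square field_simps)
      finally show False
        using \<open>0 < q\<close> \<open>0 < (norm z)\<^sup>2\<close> by (simp add: n_def divide_le_0_iff mult_le_0_iff)
    qed
  qed
  then have "T *v w = l *\<^sub>R w"
    by (simp add: g_def)
  also have "\<dots> = of_real l *s w"
    by (simp add: vec_eq_iff scaleR_conv_of_real [where 'a = complex])
  finally have "T *v w = of_real l *s w" .
  with w show ?thesis
    by (auto simp: W_def)
qed

text \<open>Induction over the basis labels: the vectors are indexed by \<open>'n\<close> itself, so
  each label still missing leaves room for an eigenvector orthogonal to those already
  chosen.\<close>

lemma hermitian_partial_eigenbasis: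
  fixes T :: "('n::finite) cmat" and S :: "'n set"
  assumes T: "adj T = T"
  shows "\<exists>v d. \<forall>i\<in>S. T *v v i = of_real (d i) *s v i \<and>
           (\<forall>j\<in>S. cdot (v i) (v j) = (if i = j then 1 else 0))"
proof (induction S rule: finite_induct [OF finite])
  case 1
  show ?case by simp
next
  case (2 i S)
  then obtain v d where vd: "\<And>i. i \<in> S \<Longrightarrow> T *v v i = of_real (d i) *s v i"
    "\<And>i j. i \<in> S \<Longrightarrow> j \<in> S \<Longrightarrow> cdot (v i) (v j) = (if i = j then 1 else 0)"
    by blast
  then obtain w l where w: "norm w = 1" "\<And>j. j \<in> S \<Longrightarrow> cdot (v j) w = 0" "T *v w = of_real l *s w"
    using hermitian_eigenvector_orthogonal [OF T \<open>i \<notin> S\<close>, of v d] by blast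
  have "cdot w (v j) = 0" if "j \<in> S" for j
    using w(2) [OF that] cdot_cnj [of "v j" w] by simp
  moreover have "cdot w w = 1"
    using w(1) by (simp add: cdot_self)
  ultimately have "\<forall>k\<in>insert i S. T *v (v(i := w)) k = of_real ((d(i := l)) k) *s (v(i := w)) k \<and>
      (\<forall>j\<in>insert i S. cdot ((v(i := w)) k) ((v(i := w)) j) = (if k = j then 1 else 0))"
    using vd w(2,3) \<open>i \<notin> S\<close> by auto
  then show ?case
    by blast
qed

section \<open>Functions of a Hermitian matrix in a fixed eigenbasis\<close>

definition unitary :: "('n::finite) cmat \<Rightarrow> bool" where
  "unitary V \<longleftrightarrow> adj V ** V = mat 1 \<and> V ** adj V = mat 1"

definition spect :: "('n::finite) cmat \<Rightarrow> ('n \<Rightarrow> real) \<Rightarrow> 'n cmat" where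
  "spect V d = V ** diagm d ** adj V"

theorem hermitian_spectral:
  fixes T :: "('n::finite) cmat"
  assumes "adj T = T"
  obtains V d where "unitary V" "T = spect V d"
proof -
  obtain v :: "'n \<Rightarrow> complex ^ 'n" and d where vd: "\<forall>i. T *v v i = of_real (d i) *s v i \<and>
      (\<forall>j. cdot (v i) (v j) = (if i = j then 1 else 0))"
    using hermitian_partial_eigenbasis [OF assms, of UNIV] unfolding ball_UNIV by blast
  have eig: "T *v v i = of_real (d i) *s v i" for i
    using vd by blast
  have orth: "cdot (v i) (v j) = (if i = j then 1 else 0)" for i j
    using vd by blast
  define V where "V = (\<chi> k i. v i $ k)"
  have "adj V ** V = mat 1"
    using orth by (simp add: V_def adj_def matrix_matrix_mult_def mat_def vec_eq_iff cdot_def)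
  then have V: "unitary V"
    by (simp add: unitary_def matrix_left_right_inverse)
  have "T ** V = V ** diagm d"
  proof -
    have "(T ** V) $ k $ i = (V ** diagm d) $ k $ i" for k i
      using arg_cong [OF eig [of i], of "\<lambda>w. w $ k"]
      by (simp add: V_def diagm_def matrix_matrix_mult_def matrix_vector_mult_def
          if_distrib [where f = "\<lambda>x. _ * x"] mult.commute cong: if_cong)
    then show ?thesis
      by (simp add: vec_eq_iff)
  qed
  then have "T ** (V ** adj V) = V ** diagm d ** adj V"
    by (simp add: matrix_mul_assoc)
  then have "T = V ** diagm d ** adj V"
    using V by (simp add: unitary_def)
  with V that show thesis
    by (simp add: spect_def)
qed

lemma spect_mult:
  assumes "unitary V"
  shows "spect V d ** spect V e = spect V (\<lambda>i. d i * e i)"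
proof -
  have "spect V d ** spect V e = V ** diagm d ** (adj V ** V) ** diagm e ** adj V"
    by (simp add: spect_def matrix_mul_assoc)
  also have "\<dots> = V ** (diagm d ** diagm e) ** adj V"
    using assms by (simp add: unitary_def matrix_mul_assoc)
  finally show ?thesis
    by (simp add: spect_def diagm_mult)
qed

lemma spect_diff: "spect V d - spect V e = spect V (\<lambda>i. d i - e i)"
proof -
  have "diagm d - diagm e = diagm (\<lambda>i. d i - e i)"
    by (simp add: diagm_def vec_eq_iff)
  then show ?thesis
    by (simp add: spect_def matrix_diff_ldistrib [symmetric] matrix_diff_rdistrib [symmetric])
qed

lemma spect_1:
  fixes V :: "('n::finite) cmat"
  assumes "unitary V"
  shows "spect V (\<lambda>i. 1) = mat 1"
proof -
  have "diagm (\<lambda>i. 1) = (mat 1 :: 'n cmat)"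
    by (simp add: diagm_def mat_def vec_eq_iff)
  with assms show ?thesis
    by (simp add: spect_def unitary_def)
qed

lemma adj_spect [simp]: "adj (spect V d) = spect V d"
proof -
  have "adj (diagm d) = diagm d"
    by (simp add: diagm_def adj_def vec_eq_iff)
  then show ?thesis
    by (simp add: spect_def adj_mult matrix_mul_assoc)
qed

lemma trace_spect: "unitary V \<Longrightarrow> trace (spect V d) = of_real (\<Sum>i\<in>UNIV. d i)"
proof -
  assume "unitary V"
  then have "trace (spect V d) = trace (diagm d)"
    using trace_mul_sym [of "V ** diagm d" "adj V"]
    by (simp add: spect_def unitary_def matrix_mul_assoc)
  then show ?thesis
    by (simp add: trace_def diagm_def)
qed

lemma cdot_spect: "cdot v (spect V d *v v) = of_real (\<Sum>i\<in>UNIV. d i * (cmod ((adj V *v v) $ i))\<^sup>2)"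
proof -
  have "cdot v (spect V d *v v) = cdot (adj V *v v) (diagm d *v (adj V *v v))"
    by (simp add: spect_def matrix_vector_mul_assoc [symmetric] cdot_adj [of v V])
  also have "\<dots> = (\<Sum>i\<in>UNIV. cnj ((adj V *v v) $ i) * (of_real (d i) * (adj V *v v) $ i))"
    unfolding cdot_def
    by (simp add: diagm_vector)
  also have "\<dots> = of_real (\<Sum>i\<in>UNIV. d i * (cmod ((adj V *v v) $ i))\<^sup>2)"
    unfolding of_real_sum of_real_mult complex_norm_square
    by (rule sum.cong) (auto simp: mult.commute mult.left_commute)
  finally show ?thesis .
qed

lemma psd_spect: "(\<And>i. 0 \<le> d i) \<Longrightarrow> psd (spect V d)"
  by (simp add: psd_iff cdot_spect sum_nonneg)

text \<open>Evaluated at the \<open>i\<close>-th column of \<open>V\<close>, an eigenvector, the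
  quadratic form returns \<open>d i\<close>.\<close>

lemma psd_spect_nonneg:
  assumes "unitary V" "psd (spect V d)"
  shows "0 \<le> d i"
proof -
  have *: "adj V *v (V *v axis i 1) = axis i 1"
    using assms by (simp add: matrix_vector_mul_assoc unitary_def)
  have "cdot (V *v axis i 1) (spect V d *v (V *v axis i 1)) = of_real (d i)"
  proof -
    have "(\<Sum>j\<in>UNIV. d j * (cmod (axis i 1 $ j))\<^sup>2) = (\<Sum>j\<in>UNIV. if j = i then d j else 0)"
      by (rule sum.cong) (auto simp: axis_def)
    with * show ?thesis
      by (simp add: cdot_spect)
  qed
  moreover have "0 \<le> Re (cdot (V *v axis i 1) (spect V d *v (V *v axis i 1)))"
    using assms(2) by (simp add: psd_iff)
  ultimately show ?thesis
    by simp
qed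

subsection \<open>Square roots and pseudoinverses\<close>

text \<open>Factoring \<open>P\<close> as \<open>B ** B\<close> turns traces involving
  \<open>P\<close> into Hilbert--Schmidt inner products, to which the Cauchy--Schwarz inequality
  applies.\<close>

lemma psd_root:
  assumes "psd P"
  obtains B where "psd B" "P = B ** B"
proof -
  obtain V d where V: "unitary V" "P = spect V d"
    using hermitian_spectral psd_hermitian assms by blast
  then have d: "0 \<le> d i" for i
    using psd_spect_nonneg assms by blast
  then have "P = spect V (\<lambda>i. sqrt (d i)) ** spect V (\<lambda>i. sqrt (d i))"
    using V by (simp add: spect_mult)
  moreover have "psd (spect V (\<lambda>i. sqrt (d i)))"
    using d by (simp add: psd_spect)
  ultimately show thesis
    using that by blast
qed

lemma trace_zero [simp]: "trace (0 :: ('n::finite) cmat) = 0"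
  by (simp add: trace_def)

lemma Re_trace_adj_mult: "Re (trace (adj P ** P)) = (norm P)\<^sup>2"
  by (simp add: inner_eq_Re_trace [symmetric] power2_norm_eq_inner)

lemma psd_Re_trace_eq_0:
  assumes "psd P" "Re (trace P) = 0"
  shows "P = 0"
proof -
  obtain B where B: "psd B" "P = B ** B"
    using psd_root assms(1) by blast
  then have "(norm B)\<^sup>2 = 0"
    using assms(2) by (simp add: Re_trace_adj_mult [symmetric] psd_hermitian)
  with B show ?thesis
    by simp
qed

text \<open>For a root \<open>B\<close> of \<open>P\<close> the trace is the squared
  Hilbert--Schmidt norm of \<open>B ** Q\<close>.\<close>

lemma psd_Re_trace_conjugate_eq_0:
  assumes "psd P" "Re (trace (adj Q ** P ** Q)) = 0"
  shows "P ** Q = 0"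
proof -
  obtain B where B: "psd B" "P = B ** B"
    using psd_root assms(1) by blast
  then have "adj Q ** P ** Q = adj (B ** Q) ** (B ** Q)"
    by (simp add: adj_mult psd_hermitian matrix_mul_assoc)
  then have "B ** Q = 0"
    using assms(2) by (simp add: Re_trace_adj_mult)
  then have "B ** (B ** Q) = 0"
    by simp
  with B show ?thesis
    by (simp add: matrix_mul_assoc)
qed

text \<open>The difference \<open>D\<close> satisfies \<open>S ** D + D ** Q = 0\<close>.
  Multiplying by \<open>D\<close> and taking the trace leaves two nonnegative terms with sum zero,
  so \<open>S ** D\<close> and \<open>Q ** D\<close> vanish, and with them \<open>D ** D\<close>.
  This uniqueness justifies the \<open>THE\<close> in \<open>msqrt\<close>.\<close>

lemma psd_square_inject:
  assumes S: "psd S" and Q: "psd Q" and eq: "S ** S = Q ** Q"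
  shows "S = Q"
proof -
  define D where "D = S - Q"
  have D: "adj D = D"
    using S Q by (simp add: D_def adj_diff psd_hermitian)
  have "S ** D + D ** Q = 0"
    using eq by (simp add: D_def matrix_diff_ldistrib matrix_diff_rdistrib)
  then have "D ** (S ** D + D ** Q) = 0"
    by simp
  then have "D ** S ** D + D ** D ** Q = 0"
    by (simp add: matrix_add_ldistrib matrix_mul_assoc)
  then have "trace (D ** S ** D) + trace (D ** D ** Q) = 0"
    by (metis trace_add trace_0 mat_0)
  moreover have "trace (D ** D ** Q) = trace (D ** Q ** D)"
    using trace_mul_sym [of D "D ** Q"] by (simp add: matrix_mul_assoc)
  ultimately have "Re (trace (D ** S ** D)) + Re (trace (D ** Q ** D)) = 0"
    by (metis plus_complex.simps(1) zero_complex.simps(1))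
  moreover have "0 \<le> Re (trace (D ** S ** D))" "0 \<le> Re (trace (D ** Q ** D))"
    using psd_conjugate [OF S, of D] psd_conjugate [OF Q, of D] D psd_trace_nonneg by metis+
  ultimately have "S ** D = 0" "Q ** D = 0"
    using psd_Re_trace_conjugate_eq_0 [OF S, of D] psd_Re_trace_conjugate_eq_0 [OF Q, of D] D
    by simp_all
  then have "D ** D = 0"
    by (simp add: D_def matrix_diff_rdistrib)
  then have "(norm D)\<^sup>2 = 0"
    using D by (simp add: Re_trace_adj_mult [symmetric])
  then show ?thesis
    by (simp add: D_def)
qed

lemma msqrt_square:
  assumes "psd S"
  shows "msqrt (S ** S) = S"
  unfolding msqrt_def using assms psd_square_inject by (intro the_equality) auto

lemma
  assumes "psd P"
  shows psd_msqrt: "psd (msqrt P)" and msqrt_mult_self: "msqrt P ** msqrt P = P"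
proof -
  obtain B where "psd B" "P = B ** B"
    using psd_root assms by blast
  then show "psd (msqrt P)" "msqrt P ** msqrt P = P"
    by (simp_all add: msqrt_square)
qed

text \<open>The product of \<open>P ** H\<close> and \<open>P ** G\<close> equals
  \<open>P ** G\<close>, while its adjoint, the product in the other order, equals
  \<open>P ** H\<close>; as \<open>P ** G\<close> is Hermitian, the two agree. Likewise
  \<open>G ** P = H ** P\<close>, and then \<open>G = G ** P ** G = H ** P ** H = H\<close>.\<close>

lemma penrose_unique:
  fixes P :: "('n::finite) cmat"
  assumes G: "P ** G ** P = P" "G ** P ** G = G" "adj (P ** G) = P ** G" "adj (G ** P) = G ** P"
    and H: "P ** H ** P = P" "H ** P ** H = H" "adj (P ** H) = P ** H" "adj (H ** P) = H ** P"
  shows "G = H"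
proof -
  have "P ** H ** (P ** G) = P ** G"
    by (simp add: matrix_mul_assoc H)
  then have "P ** G = adj (P ** H ** (P ** G))"
    by (simp only: G)
  also have "\<dots> = P ** G ** (P ** H)"
    by (simp only: adj_mult [of "P ** H"] G H)
  also have "\<dots> = P ** H"
    by (simp add: matrix_mul_assoc G)
  finally have PG: "P ** G = P ** H" .
  have "G ** P ** (H ** P) = G ** P"
    by (simp add: matrix_mul_assoc [symmetric]) (simp add: matrix_mul_assoc H)
  then have "G ** P = adj (G ** P ** (H ** P))"
    by (simp only: G)
  also have "\<dots> = H ** P ** (G ** P)"
    by (simp only: adj_mult [of "G ** P"] G H)
  also have "\<dots> = H ** P"
    by (simp add: matrix_mul_assoc [symmetric]) (simp add: matrix_mul_assoc G)
  finally have GP: "G ** P = H ** P" .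
  have "G = G ** (P ** G)"
    using G by (simp add: matrix_mul_assoc)
  also have "\<dots> = H ** P ** H"
    using GP by (simp add: PG matrix_mul_assoc)
  finally show ?thesis
    using H by simp
qed

text \<open>Because \<open>inverse 0 = 0\<close>, inverting eigenvalue by eigenvalue treats the
  kernel as the Penrose equations demand.\<close>

lemma pinv_spect:
  assumes "unitary V"
  shows "pinv (spect V d) = spect V (\<lambda>i. inverse (d i))"
proof -
  let ?G = "spect V (\<lambda>i. inverse (d i))"
  have [simp]: "a * inverse a * a = a" for a :: real
    by (cases "a = 0") auto
  have [simp]: "inverse a * a * inverse a = inverse a" for a :: real
    by (cases "a = 0") auto
  show ?thesis
    unfolding pinv_def using assms
    by (intro the_equality, simp add: spect_mult) (rule penrose_unique [of "spect V d"], auto simp: spect_mult)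
qed

subsection \<open>The trace norm of Hermitian matrices\<close>

lemma trace_norm_spect:
  assumes "unitary V"
  shows "trace_norm (spect V d) = (\<Sum>i\<in>UNIV. \<bar>d i\<bar>)"
proof -
  have "adj (spect V d) ** spect V d = spect V (\<lambda>i. \<bar>d i\<bar>) ** spect V (\<lambda>i. \<bar>d i\<bar>)"
    using assms by (simp add: spect_mult)
  then show ?thesis
    using assms by (simp add: trace_norm_def msqrt_square psd_spect trace_spect)
qed

lemma trace_norm_sign:
  assumes "adj T = T"
  obtains U where "adj U = U" "U ** U = mat 1" "trace_norm T = Re (trace (U ** T))"
proof -
  obtain V d where V: "unitary V" "T = spect V d"
    using hermitian_spectral assms by blast
  \<comment> \<open>The sign of the eigenvalue \<open>0\<close> is taken to be \<open>1\<close>, so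
    that \<open>U\<close> squares to the identity and not merely to a projection.\<close>
  define U where "U = spect V (\<lambda>i. if d i < 0 then -1 else 1)"
  have "(if d i < 0 then -1 else 1) * d i = \<bar>d i\<bar>" for i
    by simp
  then have "Re (trace (U ** T)) = trace_norm T"
    using V by (simp add: U_def spect_mult trace_spect trace_norm_spect)
  moreover have "U ** U = mat 1"
    using V by (simp add: U_def spect_mult spect_1 [symmetric] if_distrib [where f = "\<lambda>x. x * _"] cong: if_cong)
  ultimately show thesis
    using that [of U] by (simp add: U_def)
qed

lemma trace_norm_jordan:
  assumes "adj T = T"
  obtains P N where "psd P" "psd N" "T = P - N" "trace_norm T = Re (trace P) + Re (trace N)"
proof -
  obtain V d where V: "unitary V" "T = spect V d"
    using hermitian_spectral assms by blast
  define P where "P = spect V (\<lambda>i. max 0 (d i))"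
  define N where "N = spect V (\<lambda>i. max 0 (- d i))"
  have "max 0 (d i) - max 0 (- d i) = d i" "max 0 (d i) + max 0 (- d i) = \<bar>d i\<bar>" for i
    by simp_all
  then have "T = P - N" "trace_norm T = Re (trace P) + Re (trace N)"
    using V by (simp_all add: P_def N_def spect_diff trace_spect trace_norm_spect
        sum.distrib [symmetric])
  moreover have "psd P" "psd N"
    by (simp_all add: P_def N_def psd_spect)
  ultimately show thesis
    using that by blast
qed

text \<open>For a root \<open>B\<close> of \<open>P\<close> the left side is an inner product of
  \<open>B\<close> and \<open>U ** B\<close>, which have equal norm because \<open>U\<close> is
  unitary.\<close>

lemma abs_trace_mult_involution_le:
  assumes P: "psd P" and U: "adj U = U" "U ** U = mat 1"
  shows "\<bar>Re (trace (U ** P))\<bar> \<le> Re (trace P)"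
proof -
  obtain B where B: "psd B" "P = B ** B"
    using psd_root assms(1) by blast
  have B': "adj B = B"
    using B psd_hermitian by blast
  have "trace (U ** P) = trace (adj B ** (U ** B))"
    using trace_mul_sym [of "U ** B" B] B B' by (simp add: matrix_mul_assoc)
  then have "\<bar>Re (trace (U ** P))\<bar> \<le> norm B * norm (U ** B)"
    by (simp add: inner_eq_Re_trace [symmetric] Cauchy_Schwarz_ineq2)
  also have "norm (U ** B) = norm B"
  proof -
    have "adj (U ** B) ** (U ** B) = adj B ** (adj U ** U) ** B"
      by (simp add: adj_mult matrix_mul_assoc)
    then have "(norm (U ** B))\<^sup>2 = (norm B)\<^sup>2"
      using U by (simp add: Re_trace_adj_mult [symmetric])
    then show ?thesis
      by simp
  qed
  also have "norm B * norm B = Re (trace P)"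
    using Re_trace_adj_mult [of B] B B' by (simp add: power2_eq_square)
  finally show ?thesis .
qed

text \<open>The Jordan decomposition attains equality, so the trace norm is a minimum over
  decompositions. The triangle inequality and the contraction property below follow by transforming
  Jordan decompositions.\<close>

lemma trace_norm_diff_le:
  assumes "psd P" "psd N"
  shows "trace_norm (P - N) \<le> Re (trace P) + Re (trace N)"
proof -
  have "adj (P - N) = P - N"
    using assms by (simp add: adj_diff psd_hermitian)
  then obtain U where U: "adj U = U" "U ** U = mat 1"
    "trace_norm (P - N) = Re (trace (U ** (P - N)))"
    using trace_norm_sign by blast
  then have "trace_norm (P - N) = Re (trace (U ** P)) - Re (trace (U ** N))"
    by (simp add: matrix_diff_ldistrib trace_sub)
  then show ?thesis
    using abs_trace_mult_involution_le [OF assms(1) U(1,2)]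
      abs_trace_mult_involution_le [OF assms(2) U(1,2)] by linarith
qed

lemma abs_trace_le_trace_norm:
  assumes "adj T = T"
  shows "\<bar>Re (trace T)\<bar> \<le> trace_norm T"
proof -
  obtain P N where PN: "psd P" "psd N" "T = P - N" "trace_norm T = Re (trace P) + Re (trace N)"
    using trace_norm_jordan assms by blast
  then show ?thesis
    using psd_trace_nonneg [of P] psd_trace_nonneg [of N] by (simp add: trace_sub)
qed

lemma trace_norm_add:
  assumes "adj S = S" "adj T = T"
  shows "trace_norm (S + T) \<le> trace_norm S + trace_norm T"
proof -
  obtain P N where PN: "psd P" "psd N" "S = P - N" "trace_norm S = Re (trace P) + Re (trace N)"
    using trace_norm_jordan assms by blast
  obtain P' N' where PN': "psd P'" "psd N'" "T = P' - N'" "trace_norm T = Re (trace P') + Re (trace N')"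
    using trace_norm_jordan assms by blast
  have "S + T = (P + P') - (N + N')"
    by (simp add: PN PN')
  moreover have "trace_norm (P + P' - (N + N')) \<le> Re (trace (P + P')) + Re (trace (N + N'))"
    using PN(1,2) PN'(1,2) by (intro trace_norm_diff_le psd_add)
  ultimately show ?thesis
    using PN(4) PN'(4) by (simp add: trace_add)
qed

lemma trace_norm_minus:
  assumes "adj T = T"
  shows "trace_norm (- T) \<le> trace_norm T"
proof -
  obtain P N where PN: "psd P" "psd N" "T = P - N" "trace_norm T = Re (trace P) + Re (trace N)"
    using trace_norm_jordan assms by blast
  then show ?thesis
    using trace_norm_diff_le [of N P] by simp
qed

lemma trace_norm_diff:
  assumes "adj S = S" "adj T = T"
  shows "trace_norm (S - T) \<le> trace_norm S + trace_norm T"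
proof -
  have "adj (- T) = - T"
    using assms(2) by (metis adj_diff diff_0 adj_diff diff_self)
  then show ?thesis
    using trace_norm_add [of S "- T"] trace_norm_minus [of T] assms by simp
qed

text \<open>The Jordan decomposition of \<open>T\<close> is mapped to a decomposition of
  \<open>f T\<close> into positive semidefinite parts with the same traces.\<close>

lemma trace_norm_positive_map:
  assumes "adj T = T"
    and diff: "\<And>P N. f (P - N) = f P - f N"
    and psd: "\<And>P. psd P \<Longrightarrow> psd (f P)"
    and trace: "\<And>P. trace (f P) = trace P"
  shows "trace_norm (f T) \<le> trace_norm T"
proof -
  obtain P N where PN: "psd P" "psd N" "T = P - N" "trace_norm T = Re (trace P) + Re (trace N)"
    using trace_norm_jordan assms(1) by blast
  then show ?thesis
    using trace_norm_diff_le [OF psd psd, of P N] by (simp add: diff trace)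
qed

subsection \<open>Weighted second moments\<close>

text \<open>
  For invertible \<open>w\<close> this says that the weighted second moment \<open>Tr (adj Z w\<^sup>-\<^sup>1 Z)\<close> is at most \<open>t\<close>;
  the matrix \<open>L\<close> plays the role of \<open>w\<^sup>-\<^sup>1 Z\<close>.
\<close>

definition second_moment_le :: "('n::finite) cmat \<Rightarrow> 'n cmat \<Rightarrow> real \<Rightarrow> bool" where
  "second_moment_le w Z t \<longleftrightarrow> (\<exists>L. Z = w ** L \<and> Re (trace (adj L ** Z)) \<le> t)"

text \<open>With the sign \<open>U\<close> of \<open>K\<close> and a root \<open>C\<close> of
  \<open>w\<close>, the trace norm is the inner product of \<open>C ** U\<close> and
  \<open>C ** L\<close>. The squared norm of the first is \<open>Tr w\<close> since
  \<open>U ** U = mat 1\<close>; that of the second is the second moment.\<close>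

lemma trace_norm_le_second_moment:
  assumes w: "psd w" and K: "adj K = K" and t: "second_moment_le w K t"
  shows "trace_norm K \<le> sqrt (Re (trace w) * t)"
proof -
  obtain L where L: "K = w ** L" "Re (trace (adj L ** K)) \<le> t"
    using t by (auto simp: second_moment_le_def)
  obtain U where U: "adj U = U" "U ** U = mat 1" "trace_norm K = Re (trace (U ** K))"
    using trace_norm_sign [OF K] by blast
  obtain C where C: "psd C" "w = C ** C"
    using psd_root w by blast
  have C': "adj C = C"
    using C psd_hermitian by blast
  have "trace_norm K = inner (C ** U) (C ** L)"
    using U C C' L by (simp add: inner_eq_Re_trace adj_mult matrix_mul_assoc)
  also have "\<dots> \<le> norm (C ** U) * norm (C ** L)"
    by (rule norm_cauchy_schwarz)
  also have "\<dots> = sqrt ((norm (C ** U))\<^sup>2 * (norm (C ** L))\<^sup>2)"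
    by (simp add: real_sqrt_mult)
  also have "(norm (C ** U))\<^sup>2 = Re (trace w)"
  proof -
    have "trace (adj (C ** U) ** (C ** U)) = trace (U ** (w ** U))"
      using C C' U by (simp add: adj_mult matrix_mul_assoc)
    also have "\<dots> = trace (w ** (U ** U))"
      using trace_mul_sym [of U "w ** U"] by (simp add: matrix_mul_assoc)
    finally show ?thesis
      using U by (simp add: Re_trace_adj_mult [symmetric])
  qed
  also have "(norm (C ** L))\<^sup>2 = Re (trace (adj L ** K))"
    using C C' L by (simp add: Re_trace_adj_mult [symmetric] adj_mult matrix_mul_assoc)
  also have "sqrt (Re (trace w) * Re (trace (adj L ** K))) \<le> sqrt (Re (trace w) * t)"
    using L psd_trace_nonneg [OF w] by (intro real_sqrt_le_mono mult_left_mono)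
  finally show ?thesis .
qed

text \<open>Formally this is \<open>Tr (R w^-1 R) <= r Tr R\<close>. For
  \<open>t = Tr (adj L R)\<close>, the Cauchy--Schwarz inequality bounds \<open>t^2\<close> by
  \<open>Tr (adj L R L) Tr R\<close>, and domination bounds the first factor by \<open>r t\<close>;
  a factor \<open>t\<close> then cancels.\<close>

lemma second_moment_le_of_domination:
  assumes w: "psd w" and R: "psd R" and dom: "psd (r *\<^sub>R w - R)" and L: "R = w ** L" and "0 \<le> r"
  shows "second_moment_le w R (r * Re (trace R))"
proof -
  obtain B where B: "psd B" "R = B ** B"
    using psd_root R by blast
  have B': "adj B = B"
    using B psd_hermitian by blast
  define t where "t = Re (trace (adj L ** R))"
  have "t = inner (B ** L) B"
    using B B' by (simp add: t_def inner_eq_Re_trace adj_mult matrix_mul_assoc)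
  also have "\<dots> \<le> norm (B ** L) * norm B"
    by (rule norm_cauchy_schwarz)
  finally have 1: "t \<le> norm (B ** L) * norm B" .
  have "(norm (B ** L))\<^sup>2 = Re (trace (adj L ** R ** L))"
    using B B' by (simp add: Re_trace_adj_mult [symmetric] adj_mult matrix_mul_assoc)
  also have "\<dots> \<le> Re (trace (adj L ** (r *\<^sub>R w) ** L))"
    using psd_trace_nonneg [OF psd_conjugate [OF dom, of L]]
    by (simp add: matrix_diff_ldistrib matrix_diff_rdistrib trace_sub)
  also have "\<dots> = r * t"
    by (simp add: t_def L scaleR_mult_left scaleR_mult_right trace_scaleR matrix_mul_assoc)
  finally have 2: "(norm (B ** L))\<^sup>2 \<le> r * t" .
  have 3: "(norm B)\<^sup>2 = Re (trace R)"
    using B B' by (simp add: Re_trace_adj_mult [symmetric])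
  have "t \<le> r * Re (trace R)"
  proof (cases "t \<le> 0")
    case True
    then show ?thesis
      using \<open>0 \<le> r\<close> psd_trace_nonneg [OF R] by (meson mult_nonneg_nonneg order_trans)
  next
    case False
    have "t * t \<le> (norm (B ** L) * norm B)\<^sup>2"
      using 1 False by (simp add: power2_eq_square [symmetric] power_mono)
    also have "\<dots> \<le> r * t * Re (trace R)"
      using 2 3 by (simp add: power_mult_distrib mult_right_mono psd_trace_nonneg R)
    finally have "t * t \<le> t * (r * Re (trace R))"
      by (simp add: mult_ac)
    then show ?thesis
      using False by simp
  qed
  then show ?thesis
    using L by (auto simp: second_moment_le_def t_def)
qed

text \<open>
  The last hypothesis says that \<open>L'\<close> is the projection of \<open>L\<close> onto a subspace with respect to the
  inner product \<open>(S, T) \<mapsto> Tr (adj S w T)\<close>.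
\<close>

lemma second_moment_le_diff_projection:
  assumes w: "psd w" and L: "Z = w ** L" "Re (trace (adj L ** Z)) \<le> t"
    and L': "Z' = w ** L'" "trace (adj L' ** Z) = trace (adj L' ** Z')"
  shows "second_moment_le w (Z - Z') t"
proof -
  \<comment> \<open>Both cross terms have the real part of \<open>Tr (adj L' Z')\<close>, so, as in
    Pythagoras' theorem, subtracting the projection lowers the moment by exactly this nonnegative
    amount.\<close>
  have "adj (adj L' ** Z) = adj L ** Z'"
    using psd_hermitian [OF w] L L' by (simp add: adj_mult matrix_mul_assoc)
  then have "trace (adj L ** Z') = cnj (trace (adj L' ** Z))"
    by (metis trace_adj)
  moreover have "0 \<le> Re (trace (adj L' ** Z'))"
    using psd_trace_nonneg [OF psd_conjugate [OF w, of L']] L' by (simp add: matrix_mul_assoc)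
  ultimately have "Re (trace (adj (L - L') ** (Z - Z'))) \<le> t"
    using L L' by (simp add: adj_diff matrix_diff_ldistrib matrix_diff_rdistrib trace_sub)
  moreover have "Z - Z' = w ** (L - L')"
    using L L' by (simp add: matrix_diff_ldistrib)
  ultimately show ?thesis
    by (auto simp: second_moment_le_def)
qed

subsection \<open>Consequences of bounds on the smooth max-relative entropy\<close>

text \<open>The vector \<open>P *v (P *v w)\<close> lies in the support of \<open>P\<close>, hence
  in that of \<open>Q\<close>, and so is orthogonal to \<open>w\<close>; this says that
  \<open>P *v w\<close> has norm zero.\<close>

lemma kernel_subset_of_supp_subset:
  assumes P: "psd P" and "supp P \<subseteq> supp Q" and w: "Q *v w = 0"
  shows "P *v w = 0"
proof -
  have "P *v (P *v w) \<in> supp P"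
    using psd_hermitian [OF P] by (simp add: supp_def cdot_adj [of _ P]) (simp add: cdot_def)
  then have "cdot w (P *v (P *v w)) = 0"
    using assms by (auto simp: supp_def)
  then have "cdot (P *v w) (P *v w) = 0"
    using psd_hermitian [OF P] by (simp add: cdot_adj [of w])
  then show ?thesis
    by (simp add: cdot_self)
qed

text \<open>These are the two inputs of the second moment bound: domination by a multiple of
  \<open>Q\<close>, and a matrix acting as \<open>Q^-1 P\<close>, which the support inclusion
  provides.\<close>

lemma D_inf_domination:
  assumes P: "psd P" and Q: "psd Q" and "0 < s" and D: "D_inf P Q < ereal (log 2 s)"
  shows "psd (s *\<^sub>R Q - P)" and "\<exists>L. P = Q ** L"
proof -
  define S where "S = msqrt Q"
  define G where "G = pinv S"
  define r where "r = onorm ((*v) (G ** P ** G))"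
  have sub: "supp P \<subseteq> supp Q"
    using D by (simp add: D_inf_def split: if_splits)
  have "r < s"
  \<comment> \<open>At \<open>r = 0\<close> the entropy is \<open>-\<infinity>\<close>, so
    logarithms are compared only for nonzero \<open>r\<close>.\<close>
  proof (cases "r = 0")
    case False
    have "0 \<le> r"
      unfolding r_def by (rule onorm_pos_le) (rule matrix_vector_mul_bounded_linear)
    moreover have "log 2 r < log 2 s"
      using D sub False by (simp add: D_inf_def Let_def r_def G_def S_def)
    ultimately show ?thesis
      using False \<open>0 < s\<close> by simp
  qed (use \<open>0 < s\<close> in simp)
  have S: "psd S" "S ** S = Q"
    using Q by (simp_all add: S_def psd_msqrt msqrt_mult_self)
  obtain V d where V: "unitary V" "S = spect V d"
    using hermitian_spectral psd_hermitian S(1) by blast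
  have G: "G = spect V (\<lambda>i. inverse (d i))"
    using V by (simp add: G_def pinv_spect)
  have adjs: "adj S = S" "adj G = G"
    using V G by simp_all
  \<comment> \<open>The matrix \<open>G ** S\<close> is the orthogonal projection onto the support
    of \<open>Q\<close>; by the support inclusion it fixes \<open>P\<close> as well.\<close>
  have QGS: "Q ** (G ** S) = Q"
  proof -
    have "d i * d i * (inverse (d i) * d i) = d i * d i" for i
      by (cases "d i = 0") auto
    then have "spect V (\<lambda>i. d i * d i * (inverse (d i) * d i)) = spect V (\<lambda>i. d i * d i)"
      by presburger
    then show ?thesis
      using V by (simp only: S(2) [symmetric] G spect_mult)
  qed
  have PGS: "P ** (G ** S) = P"
  proof -
    have "P *v ((mat 1 - G ** S) *v v) = 0" for v
    proof (rule kernel_subset_of_supp_subset [OF P sub])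
      show "Q *v ((mat 1 - G ** S) *v v) = 0"
        using QGS by (simp add: matrix_vector_mul_assoc matrix_diff_ldistrib)
    qed
    then have "P ** (mat 1 - G ** S) = 0"
      unfolding matrix_eq by (simp add: matrix_vector_mul_assoc)
    then show ?thesis
      by (simp add: matrix_diff_ldistrib)
  qed
  have SGP: "S ** G ** P = P"
  proof -
    have "adj (P ** (G ** S)) = S ** G ** P"
      using adjs psd_hermitian [OF P] by (simp add: adj_mult matrix_mul_assoc)
    then show ?thesis
      using PGS psd_hermitian [OF P] by simp
  qed
  \<comment> \<open>The eigenvalue identity holds at \<open>0\<close> too. As \<open>S ** G\<close>
    fixes \<open>P\<close>, this makes \<open>G ** G ** P\<close> the required factor.\<close>
  have "S ** G = Q ** (G ** G)"
  proof -
    have "d i * inverse (d i) = d i * d i * (inverse (d i) * inverse (d i))" for i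
      by (cases "d i = 0") (auto simp: field_simps)
    then have "spect V (\<lambda>i. d i * inverse (d i)) = spect V (\<lambda>i. d i * d i * (inverse (d i) * inverse (d i)))"
      by presburger
    then show ?thesis
      using V by (simp only: S(2) [symmetric] G spect_mult)
  qed
  then have "P = Q ** (G ** G ** P)"
    using SGP by (simp add: matrix_mul_assoc)
  then show "\<exists>L. P = Q ** L"
    by blast
  have "Re (cdot v (P *v v)) \<le> s * Re (cdot v (Q *v v))" for v
  proof -
    \<comment> \<open>Sandwiching \<open>G ** P ** G\<close> between two copies of \<open>S\<close>
      recovers \<open>P\<close>, so its operator norm bounds the form of \<open>P\<close> by a
      multiple of that of \<open>S ** S = Q\<close>.\<close>
    have "P = S ** (G ** P ** G) ** S"
      using SGP PGS by (simp add: matrix_mul_assoc)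
    then have "Re (cdot v (P *v v)) = inner (S *v v) ((G ** P ** G) *v (S *v v))"
      using adjs by (metis cdot_adj inner_eq_Re_cdot matrix_vector_mul_assoc)
    also have "\<dots> \<le> norm (S *v v) * norm ((G ** P ** G) *v (S *v v))"
      by (rule norm_cauchy_schwarz)
    also have "\<dots> \<le> norm (S *v v) * (r * norm (S *v v))"
      unfolding r_def by (intro mult_left_mono onorm matrix_vector_mul_bounded_linear norm_ge_zero)
    also have "\<dots> = r * (norm (S *v v))\<^sup>2"
      by (simp add: power2_eq_square)
    also have "\<dots> \<le> s * (norm (S *v v))\<^sup>2"
      using \<open>r < s\<close> by (intro mult_right_mono) auto
    also have "(norm (S *v v))\<^sup>2 = Re (cdot v (Q *v v))"
    proof -
      have "cdot v (Q *v v) = cdot (S *v v) (S *v v)"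
        using adjs by (simp add: S(2) [symmetric] matrix_vector_mul_assoc [symmetric] cdot_adj [of v])
      then show ?thesis
        by (simp add: cdot_self)
    qed
    finally show ?thesis .
  qed
  then show "psd (s *\<^sub>R Q - P)"
    using psd_hermitian [OF P] psd_hermitian [OF Q]
    by (simp add: psd_iff adj_diff adj_scaleR matrix_vector_diff_rdistrib cdot_diff_right
        scaleR_mult_vector cdot_scaleR_right)
qed

text \<open>The rate condition places the infimum strictly below \<open>log 2 (n / c)\<close>, so
  some member of the smoothing ball is below it as well and is dominated by \<open>n / c\<close>
  times \<open>Q\<close>.\<close>

lemma D_inf_smooth_second_moment:
  assumes Q: "psd Q" and "0 < n" "0 < c"
    and D: "D_inf_smooth e P Q + ereal (log 2 c) < ereal (log 2 n)"
  obtains P' where "psd P'" "trace_norm (P' - P) \<le> e * Re (trace P)"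
    "second_moment_le Q P' (n / c * Re (trace P'))"
proof -
  have "D_inf_smooth e P Q < ereal (log 2 (n / c))"
    using D \<open>0 < n\<close> \<open>0 < c\<close> by (cases "D_inf_smooth e P Q") (simp_all add: log_divide)
  then obtain P' where P': "psd P'" "trace_norm (P' - P) \<le> e * Re (trace P)"
    "D_inf P' Q < ereal (log 2 (n / c))"
    by (auto simp: D_inf_smooth_def INF_less_iff subnormalised_def)
  have "0 < n / c"
    using \<open>0 < n\<close> \<open>0 < c\<close> by simp
  note dom = D_inf_domination [OF P'(1) Q this P'(3)]
  then obtain L where "P' = Q ** L"
    by blast
  then have "second_moment_le Q P' (n / c * Re (trace P'))"
    using \<open>0 < n / c\<close> by (intro second_moment_le_of_domination Q P'(1) dom(1)) auto
  with P' that show thesis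
    by blast
qed

subsection \<open>Tensor products, partial traces and permutations of registers\<close>

lemma sum_UNIV_prod: "(\<Sum>z\<in>UNIV. f z) = (\<Sum>x\<in>UNIV. \<Sum>y\<in>UNIV. f (x :: 'p::finite, y :: 'q::finite))"
  by (simp add: sum.cartesian_product UNIV_Times_UNIV [symmetric] del: UNIV_Times_UNIV)

lemma tensor_mult: "(P \<otimes>\<^sub>t Q) ** (P' \<otimes>\<^sub>t Q') = (P ** P') \<otimes>\<^sub>t (Q ** Q')"
  by (simp add: tensor_def matrix_matrix_mult_def vec_eq_iff sum_UNIV_prod sum_product mult_ac)

lemma adj_tensor: "adj (P \<otimes>\<^sub>t Q) = adj P \<otimes>\<^sub>t adj Q"
  by (simp add: tensor_def adj_def vec_eq_iff)

lemma trace_tensor: "trace (P \<otimes>\<^sub>t Q) = trace P * trace Q"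
  by (simp add: tensor_def trace_def sum_UNIV_prod sum_product)

lemma tensor_diff_right: "P \<otimes>\<^sub>t (Q - Q') = P \<otimes>\<^sub>t Q - P \<otimes>\<^sub>t Q'"
  by (simp add: tensor_def vec_eq_iff right_diff_distrib)

lemma psd_tensor:
  assumes "psd P" "psd Q"
  shows "psd (P \<otimes>\<^sub>t Q)"
proof -
  obtain B where B: "psd B" "P = B ** B"
    using psd_root assms(1) by blast
  obtain C where C: "psd C" "Q = C ** C"
    using psd_root assms(2) by blast
  have "P \<otimes>\<^sub>t Q = adj (B \<otimes>\<^sub>t C) ** (B \<otimes>\<^sub>t C)"
    using B C by (simp add: adj_tensor tensor_mult psd_hermitian)
  then show ?thesis
    by (simp add: psd_adj_mult)
qed

section \<open>Partial trace over the first register\<close>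

definition ptrace :: "('p::finite \<times> 'r::finite) cmat \<Rightarrow> 'r cmat" where
  "ptrace Z = (\<chi> k l. \<Sum>p\<in>UNIV. Z $ (p, k) $ (p, l))"

lemma ptrace_diff: "ptrace (P - Q) = ptrace P - ptrace Q"
  by (simp add: ptrace_def vec_eq_iff sum_subtractf)

lemma trace_ptrace: "trace (ptrace P) = trace P"
  unfolding ptrace_def trace_def by (simp add: sum_UNIV_prod) (rule sum.swap)

lemma ptrace_tensor:
  assumes "trace P = 1"
  shows "ptrace (P \<otimes>\<^sub>t Q) = Q"
proof -
  have "(\<Sum>p\<in>UNIV. P $ p $ p * Q $ k $ l) = Q $ k $ l" for k l
    using assms by (simp add: trace_def sum_distrib_right [symmetric])
  then show ?thesis
    by (simp add: ptrace_def tensor_def vec_eq_iff)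
qed

text \<open>The form of \<open>ptrace P\<close> at \<open>v\<close> is the sum over \<open>p\<close>
  of the form of \<open>P\<close> at the tensor product of the basis vector \<open>e_p\<close> with
  \<open>v\<close>.\<close>

lemma psd_ptrace:
  assumes "psd P"
  shows "psd (ptrace P)"
proof -
  have "cdot v (ptrace P *v v) =
      (\<Sum>p\<in>UNIV. cdot (\<chi> z. if fst z = p then v $ snd z else 0)
        (P *v (\<chi> z. if fst z = p then v $ snd z else 0)))" for v
  proof -
    have "cdot v (ptrace P *v v) = (\<Sum>k\<in>UNIV. \<Sum>l\<in>UNIV. \<Sum>p\<in>UNIV. cnj (v $ k) * (P $ (p, k) $ (p, l) * v $ l))"
      by (simp add: cdot_def ptrace_def matrix_vector_mult_def sum_distrib_left sum_distrib_right)
    also have "\<dots> = (\<Sum>k\<in>UNIV. \<Sum>p\<in>UNIV. \<Sum>l\<in>UNIV. cnj (v $ k) * (P $ (p, k) $ (p, l) * v $ l))"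
      by (rule sum.cong [OF refl], rule sum.swap)
    also have "\<dots> = (\<Sum>p\<in>UNIV. \<Sum>k\<in>UNIV. \<Sum>l\<in>UNIV. cnj (v $ k) * (P $ (p, k) $ (p, l) * v $ l))"
      by (rule sum.swap)
    also have "\<dots> = (\<Sum>p\<in>UNIV. cdot (\<chi> z. if fst z = p then v $ snd z else 0)
        (P *v (\<chi> z. if fst z = p then v $ snd z else 0)))"
    proof (rule sum.cong [OF refl])
      fix p :: 'a
      have inner: "(\<Sum>q\<in>UNIV. \<Sum>l\<in>UNIV. P $ z $ (q, l) * (if q = p then v $ l else 0)) =
          (\<Sum>l\<in>UNIV. P $ z $ (p, l) * v $ l)" for z
      proof -
        have "(\<Sum>q\<in>UNIV. \<Sum>l\<in>UNIV. P $ z $ (q, l) * (if q = p then v $ l else 0)) =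
            (\<Sum>q\<in>UNIV. if q = p then \<Sum>l\<in>UNIV. P $ z $ (p, l) * v $ l else 0)"
          by (rule sum.cong) auto
        then show ?thesis
          by simp
      qed
      have "cdot (\<chi> z. if fst z = p then v $ snd z else 0)
          (P *v (\<chi> z. if fst z = p then v $ snd z else 0)) =
          (\<Sum>q\<in>UNIV. \<Sum>k\<in>UNIV. cnj (if q = p then v $ k else 0) * (\<Sum>l\<in>UNIV. P $ (q, k) $ (p, l) * v $ l))"
        by (simp add: cdot_def matrix_vector_mult_def sum_UNIV_prod inner cong: if_cong)
      also have "\<dots> = (\<Sum>q\<in>UNIV. if q = p then \<Sum>k\<in>UNIV. cnj (v $ k) * (\<Sum>l\<in>UNIV. P $ (p, k) $ (p, l) * v $ l) else 0)"
        by (rule sum.cong) auto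
      also have "\<dots> = (\<Sum>k\<in>UNIV. cnj (v $ k) * (\<Sum>l\<in>UNIV. P $ (p, k) $ (p, l) * v $ l))"
        by simp
      finally show "(\<Sum>k\<in>UNIV. \<Sum>l\<in>UNIV. cnj (v $ k) * (P $ (p, k) $ (p, l) * v $ l)) =
          cdot (\<chi> z. if fst z = p then v $ snd z else 0) (P *v (\<chi> z. if fst z = p then v $ snd z else 0))"
        by (simp add: sum_distrib_left)
    qed
    finally show ?thesis .
  qed
  with assms show ?thesis
    by (simp add: psd_def complex_nonneg_Reals_iff sum_nonneg)
qed

lemma ptrace_tensor_1_mult:
  fixes P :: "('r::finite) cmat" and Z :: "('p::finite \<times> 'r) cmat"
  shows "ptrace ((mat 1 \<otimes>\<^sub>t P) ** Z) = P ** ptrace Z"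
proof -
  have "(\<Sum>p\<in>UNIV. \<Sum>q\<in>UNIV. \<Sum>j\<in>UNIV. (mat 1 :: 'p cmat) $ p $ q * P $ k $ j * Z $ (q, j) $ (p, l)) =
      (\<Sum>j\<in>UNIV. \<Sum>p\<in>UNIV. P $ k $ j * Z $ (p, j) $ (p, l))" (is "?lhs = ?rhs") for k l
  proof -
    have "?lhs = (\<Sum>p\<in>UNIV. \<Sum>q\<in>UNIV. if q = p then \<Sum>j\<in>UNIV. P $ k $ j * Z $ (p, j) $ (p, l) else 0)"
      by (intro sum.cong refl) (auto simp: mat_def)
    also have "\<dots> = (\<Sum>p\<in>UNIV. \<Sum>j\<in>UNIV. P $ k $ j * Z $ (p, j) $ (p, l))"
      by simp
    also have "\<dots> = ?rhs"
      by (rule sum.swap)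
    finally show ?thesis .
  qed
  then show ?thesis
    by (simp add: ptrace_def tensor_def matrix_matrix_mult_def vec_eq_iff sum_UNIV_prod sum_distrib_left)
qed

text \<open>Replacing the first register by \<open>alpha\<close> is the orthogonal projection onto
  operators with tensor factor \<open>alpha\<close>, for the inner product weighted by the inverse
  of \<open>alpha \<otimes>\<^sub>t w\<close>.\<close>

lemma second_moment_le_center:
  assumes alpha: "psd alpha" "trace alpha = 1" and w: "psd w"
    and t: "second_moment_le (alpha \<otimes>\<^sub>t w) Z t"
  shows "second_moment_le (alpha \<otimes>\<^sub>t w) (Z - alpha \<otimes>\<^sub>t ptrace Z) t"
proof -
  obtain L where L: "Z = (alpha \<otimes>\<^sub>t w) ** L" "Re (trace (adj L ** Z)) \<le> t"
    using t by (auto simp: second_moment_le_def)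
  \<comment> \<open>This plays the role of \<open>w^-1 ** ptrace Z\<close>; built from
    \<open>L\<close>, it is available for singular \<open>w\<close> too.\<close>
  define l where "l = ptrace ((alpha \<otimes>\<^sub>t mat 1) ** L)"
  have "alpha \<otimes>\<^sub>t w = (mat 1 \<otimes>\<^sub>t w) ** (alpha \<otimes>\<^sub>t mat 1)"
    by (simp add: tensor_mult)
  then have Z: "ptrace Z = w ** l"
    by (simp add: L(1) l_def matrix_mul_assoc [symmetric] ptrace_tensor_1_mult)
  show ?thesis
  proof (rule second_moment_le_diff_projection [OF psd_tensor [OF alpha(1) w] L])
    show "alpha \<otimes>\<^sub>t ptrace Z = (alpha \<otimes>\<^sub>t w) ** (mat 1 \<otimes>\<^sub>t l)"
      by (simp add: Z tensor_mult)
    have "trace (adj (mat 1 \<otimes>\<^sub>t l) ** Z) = trace (ptrace ((mat 1 \<otimes>\<^sub>t adj l) ** Z))"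
      by (simp add: trace_ptrace adj_tensor)
    also have "\<dots> = trace (adj l ** ptrace Z)"
      by (simp add: ptrace_tensor_1_mult)
    also have "\<dots> = trace (adj (mat 1 \<otimes>\<^sub>t l) ** (alpha \<otimes>\<^sub>t ptrace Z))"
      using alpha by (simp add: adj_tensor tensor_mult trace_tensor)
    finally show "trace (adj (mat 1 \<otimes>\<^sub>t l) ** Z) = trace (adj (mat 1 \<otimes>\<^sub>t l) ** (alpha \<otimes>\<^sub>t ptrace Z))" .
  qed
qed

section \<open>Permutations of registers\<close>

definition reindex :: "('p::finite \<Rightarrow> 'q::finite) \<Rightarrow> 'q cmat \<Rightarrow> 'p cmat" where
  "reindex h P = (\<chi> i j. P $ h i $ h j)"

lemma reindex_mult:
  assumes "bij h"
  shows "reindex h (P ** Q) = reindex h P ** reindex h Q"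
proof -
  have "(\<Sum>k\<in>UNIV. P $ i $ k * Q $ k $ j) = (\<Sum>k\<in>UNIV. P $ i $ h k * Q $ h k $ j)" for i j
    by (rule sum.reindex_bij_betw [OF assms, symmetric])
  then show ?thesis
    by (simp add: reindex_def matrix_matrix_mult_def vec_eq_iff)
qed

lemma trace_reindex:
  assumes "bij h"
  shows "trace (reindex h P) = trace P"
  unfolding reindex_def trace_def using sum.reindex_bij_betw [OF assms, of "\<lambda>i. P $ i $ i"] by simp

lemma adj_reindex: "adj (reindex h P) = reindex h (adj P)"
  by (simp add: reindex_def adj_def vec_eq_iff)

lemma reindex_diff: "reindex h (P - Q) = reindex h P - reindex h Q"
  by (simp add: reindex_def vec_eq_iff)

lemma psd_reindex:
  assumes "bij h" "psd P"
  shows "psd (reindex h P)"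
proof -
  obtain B where B: "psd B" "P = B ** B"
    using psd_root assms(2) by blast
  have "reindex h P = adj (reindex h B) ** reindex h B"
    using B assms by (simp add: adj_reindex reindex_mult psd_hermitian)
  then show ?thesis
    by (simp add: psd_adj_mult)
qed

lemma second_moment_le_reindex:
  assumes "bij h" "second_moment_le w Z t"
  shows "second_moment_le (reindex h w) (reindex h Z) t"
proof -
  obtain L where L: "Z = w ** L" "Re (trace (adj L ** Z)) \<le> t"
    using assms(2) by (auto simp: second_moment_le_def)
  have "adj (reindex h L) ** reindex h Z = reindex h (adj L ** Z)"
    using assms(1) by (simp add: reindex_mult adj_reindex)
  then have "Re (trace (adj (reindex h L) ** reindex h Z)) \<le> t"
    using assms(1) L by (simp add: trace_reindex)
  moreover have "reindex h Z = reindex h w ** reindex h L"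
    using assms(1) L by (simp add: reindex_mult)
  ultimately show ?thesis
    by (auto simp: second_moment_le_def)
qed

text \<open>The swap carries facts about the first register over to the second.\<close>

definition swap_registers :: "'p \<times> 'q \<times> 'r \<Rightarrow> 'q \<times> 'p \<times> 'r" where
  "swap_registers z = (fst (snd z), fst z, snd (snd z))"

lemma swap_registers_simp [simp]: "swap_registers (x, y, m) = (y, x, m)"
  by (simp add: swap_registers_def)

lemma bij_swap_registers: "bij swap_registers"
  by (rule o_bij [of swap_registers]) (auto simp: swap_registers_def fun_eq_iff)

lemma reindex_swap_swap [simp]: "reindex swap_registers (reindex swap_registers P) = P"
  by (simp add: reindex_def vec_eq_iff swap_registers_def)

lemma reindex_swap_tensor:
  "reindex swap_registers (P \<otimes>\<^sub>t Q \<otimes>\<^sub>t R) = Q \<otimes>\<^sub>t P \<otimes>\<^sub>t R"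
  by (simp add: reindex_def tensor_def vec_eq_iff swap_registers_def)

subsection \<open>Placing an operator on chosen copies of its registers\<close>

lemma sum_prod_fun:
  fixes h :: "'a::finite \<Rightarrow> 'x::finite \<Rightarrow> complex"
  shows "(\<Sum>f\<in>UNIV. \<Prod>s\<in>UNIV. h s (f s)) = (\<Prod>s\<in>UNIV. \<Sum>x\<in>UNIV. h s x)"
  using prod_sum_PiE [of UNIV "\<lambda>_. UNIV" h] by (simp add: PiE_UNIV_domain)

lemma prod_if_split:
  fixes u v :: "'a::finite \<Rightarrow> complex"
  shows "(\<Prod>s\<in>UNIV. if s = a then u s else v s) = u a * (\<Prod>s\<in>UNIV - {a}. v s)"
proof -
  have "(\<Prod>s\<in>UNIV. if s = a then u s else v s) = u a * (\<Prod>s\<in>UNIV - {a}. if s = a then u s else v s)"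
    by (subst prod.remove [of _ a]) auto
  also have "(\<Prod>s\<in>UNIV - {a}. if s = a then u s else v s) = (\<Prod>s\<in>UNIV - {a}. v s)"
    by (rule prod.cong) auto
  finally show ?thesis .
qed

text \<open>Once the factor at \<open>a\<close> is absorbed into the product over all registers, the
  sum over functions of a product becomes a product of sums.\<close>

lemma sum_fun_split:
  fixes G :: "'x::finite \<Rightarrow> complex" and q :: "'a::finite \<Rightarrow> 'x \<Rightarrow> complex"
  shows "(\<Sum>f\<in>UNIV. G (f a) * (\<Prod>s\<in>UNIV - {a}. q s (f s))) =
    (\<Sum>x\<in>UNIV. G x) * (\<Prod>s\<in>UNIV - {a}. \<Sum>x\<in>UNIV. q s x)"
proof -
  have "(\<Sum>f\<in>UNIV. G (f a) * (\<Prod>s\<in>UNIV - {a}. q s (f s))) =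
      (\<Sum>f\<in>UNIV. \<Prod>s\<in>UNIV. if s = a then G (f s) else q s (f s))"
    by (simp add: prod_if_split [where u = "\<lambda>s. G (_ s)"])
  also have "\<dots> = (\<Prod>s\<in>UNIV. \<Sum>x\<in>UNIV. if s = a then G x else q s x)"
    by (rule sum_prod_fun)
  also have "\<dots> = (\<Prod>s\<in>UNIV. if s = a then \<Sum>x\<in>UNIV. G x else \<Sum>x\<in>UNIV. q s x)"
    by (rule prod.cong) auto
  finally show ?thesis
    by (simp add: prod_if_split)
qed

lemma sum_fun_split2:
  fixes F :: "'x::finite \<Rightarrow> 'y::finite \<Rightarrow> complex"
    and q :: "'a::finite \<Rightarrow> 'x \<Rightarrow> complex" and r :: "'b::finite \<Rightarrow> 'y \<Rightarrow> complex"
  shows "(\<Sum>f\<in>UNIV. \<Sum>g\<in>UNIV. F (f a) (g b) *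
      (\<Prod>s\<in>UNIV - {a}. q s (f s)) * (\<Prod>s\<in>UNIV - {b}. r s (g s))) =
    (\<Sum>x\<in>UNIV. \<Sum>y\<in>UNIV. F x y) *
      (\<Prod>s\<in>UNIV - {a}. \<Sum>x\<in>UNIV. q s x) * (\<Prod>s\<in>UNIV - {b}. \<Sum>y\<in>UNIV. r s y)"
proof -
  have "(\<Sum>g\<in>UNIV. F (f a) (g b) * (\<Prod>s\<in>UNIV - {a}. q s (f s)) * (\<Prod>s\<in>UNIV - {b}. r s (g s))) =
      (\<Sum>y\<in>UNIV. F (f a) y) * (\<Prod>s\<in>UNIV - {a}. q s (f s)) * (\<Prod>s\<in>UNIV - {b}. \<Sum>y\<in>UNIV. r s y)" for f
    by (subst sum_fun_split [of "\<lambda>y. F (f a) y * (\<Prod>s\<in>UNIV - {a}. q s (f s))" b r])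
       (simp add: sum_distrib_right)
  then have "(\<Sum>f\<in>UNIV. \<Sum>g\<in>UNIV. F (f a) (g b) *
      (\<Prod>s\<in>UNIV - {a}. q s (f s)) * (\<Prod>s\<in>UNIV - {b}. r s (g s))) =
      (\<Sum>f\<in>UNIV. (\<Sum>y\<in>UNIV. F (f a) y) * (\<Prod>s\<in>UNIV - {a}. q s (f s))) * (\<Prod>s\<in>UNIV - {b}. \<Sum>y\<in>UNIV. r s y)"
    by (simp add: sum_distrib_right)
  then show ?thesis
    by (simp add: sum_fun_split [of "\<lambda>x. \<Sum>y\<in>UNIV. F x y" a q])
qed

lemma placed_nth: "placed alpha beta P a b $ (f, g, m) $ (f', g', m') =
    P $ (f a, g b, m) $ (f' a, g' b, m') *
    (\<Prod>s\<in>UNIV - {a}. alpha $ f s $ f' s) * (\<Prod>s\<in>UNIV - {b}. beta $ g s $ g' s)"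
  by (simp add: placed_def tensor_entry_def)

text \<open>Both factors have the same product structure, so multiplication happens register by
  register. Taking \<open>mat 1\<close> as the fillers of one factor splits the weight off a placed
  operator.\<close>

lemma placed_mult:
  fixes P P' :: "('x::finite \<times> 'y::finite \<times> 'm::finite) cmat"
    and a :: "'a::finite" and b :: "'b::finite"
  shows "placed alpha beta P a b ** placed alpha' beta' P' a b =
    placed (alpha ** alpha') (beta ** beta') (P ** P') a b"
proof -
  have "(placed alpha beta P a b ** placed alpha' beta' P' a b) $ (f, g, m) $ (f', g', m') =
      placed (alpha ** alpha') (beta ** beta') (P ** P') a b $ (f, g, m) $ (f', g', m')"
    for f f' :: "'a \<Rightarrow> 'x" and g g' :: "'b \<Rightarrow> 'y" and m m'
  proof -
    have "(placed alpha beta P a b ** placed alpha' beta' P' a b) $ (f, g, m) $ (f', g', m') =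
        (\<Sum>h\<in>UNIV. \<Sum>k\<in>UNIV. \<Sum>n\<in>UNIV. placed alpha beta P a b $ (f, g, m) $ (h, k, n) *
          placed alpha' beta' P' a b $ (h, k, n) $ (f', g', m'))"
      by (simp add: matrix_matrix_mult_def sum_UNIV_prod)
    also have "\<dots> = (\<Sum>h\<in>UNIV. \<Sum>k\<in>UNIV.
        (\<Sum>n\<in>UNIV. P $ (f a, g b, m) $ (h a, k b, n) * P' $ (h a, k b, n) $ (f' a, g' b, m')) *
        (\<Prod>s\<in>UNIV - {a}. alpha $ f s $ h s * alpha' $ h s $ f' s) *
        (\<Prod>s\<in>UNIV - {b}. beta $ g s $ k s * beta' $ k s $ g' s))"
      by (simp add: placed_nth prod.distrib sum_distrib_left sum_distrib_right mult_ac)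
    also have "\<dots> = (\<Sum>x\<in>UNIV. \<Sum>y\<in>UNIV.
        (\<Sum>n\<in>UNIV. P $ (f a, g b, m) $ (x, y, n) * P' $ (x, y, n) $ (f' a, g' b, m'))) *
        (\<Prod>s\<in>UNIV - {a}. \<Sum>x\<in>UNIV. alpha $ f s $ x * alpha' $ x $ f' s) *
        (\<Prod>s\<in>UNIV - {b}. \<Sum>y\<in>UNIV. beta $ g s $ y * beta' $ y $ g' s)"
      by (rule sum_fun_split2 [where F = "\<lambda>x y. \<Sum>n\<in>UNIV. P $ (f a, g b, m) $ (x, y, n) * P' $ (x, y, n) $ (f' a, g' b, m')"])
    also have "\<dots> = placed (alpha ** alpha') (beta ** beta') (P ** P') a b $ (f, g, m) $ (f', g', m')"
      by (simp add: placed_nth matrix_matrix_mult_def sum_UNIV_prod)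
    finally show ?thesis .
  qed
  then show ?thesis
    by (simp add: vec_eq_iff)
qed

lemma trace_placed:
  assumes "trace alpha = 1" "trace beta = 1"
  shows "trace (placed alpha beta P a b) = trace P"
proof -
  have "trace (placed alpha beta P a b) = (\<Sum>f\<in>UNIV. \<Sum>g\<in>UNIV.
      (\<Sum>m\<in>UNIV. P $ (f a, g b, m) $ (f a, g b, m)) *
      (\<Prod>s\<in>UNIV - {a}. alpha $ f s $ f s) * (\<Prod>s\<in>UNIV - {b}. beta $ g s $ g s))"
    by (simp add: trace_def sum_UNIV_prod placed_nth sum_distrib_right)
  also have "\<dots> = (\<Sum>x\<in>UNIV. \<Sum>y\<in>UNIV. \<Sum>m\<in>UNIV. P $ (x, y, m) $ (x, y, m)) *
      (\<Prod>s\<in>UNIV - {a}. \<Sum>x\<in>UNIV. alpha $ x $ x) * (\<Prod>s\<in>UNIV - {b}. \<Sum>y\<in>UNIV. beta $ y $ y)"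
    by (rule sum_fun_split2 [where F = "\<lambda>x y. \<Sum>m\<in>UNIV. P $ (x, y, m) $ (x, y, m)"])
  finally show ?thesis
    using assms by (simp add: trace_def sum_UNIV_prod)
qed

lemma adj_placed: "adj (placed alpha beta P a b) = placed (adj alpha) (adj beta) (adj P) a b"
  by (simp add: adj_def vec_eq_iff placed_nth)

lemma placed_diff: "placed alpha beta (P - Q) a b = placed alpha beta P a b - placed alpha beta Q a b"
  by (simp add: vec_eq_iff placed_nth left_diff_distrib)

lemma psd_placed:
  assumes "psd alpha" "psd beta" "psd P"
  shows "psd (placed alpha beta P a b)"
proof -
  obtain B where B: "psd B" "P = B ** B"
    using psd_root assms(3) by blast
  obtain C where C: "psd C" "alpha = C ** C"
    using psd_root assms(1) by blast
  obtain D where D: "psd D" "beta = D ** D"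
    using psd_root assms(2) by blast
  have "placed alpha beta P a b = adj (placed C D B a b) ** placed C D B a b"
    using B C D by (simp add: adj_placed placed_mult psd_hermitian)
  then show ?thesis
    by (simp add: psd_adj_mult)
qed

lemma placed_swap:
  "placed alpha beta (reindex swap_registers P) a b = reindex swap_registers (placed beta alpha P b a)"
  by (simp add: vec_eq_iff placed_nth reindex_def mult_ac)

lemma placed_tensor:
  "placed alpha beta (alpha \<otimes>\<^sub>t T) a b $ (f, g, m) $ (f', g', m') =
    (\<Prod>s\<in>UNIV. alpha $ f s $ f' s) * T $ (g b, m) $ (g' b, m') *
    (\<Prod>s\<in>UNIV - {b}. beta $ g s $ g' s)"
proof -
  have "alpha $ f a $ f' a * (\<Prod>s\<in>UNIV - {a}. alpha $ f s $ f' s) = (\<Prod>s\<in>UNIV. alpha $ f s $ f' s)"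
    by (subst prod.remove [of UNIV a]) auto
  then show ?thesis
    by (simp add: placed_nth tensor_def mult.commute mult.left_commute)
qed

text \<open>With \<open>alpha\<close> already in the \<open>X\<close> slot, copy \<open>a\<close>
  looks like every other copy.\<close>

lemma placed_tensor_indep: "placed alpha beta (alpha \<otimes>\<^sub>t T) a b = placed alpha beta (alpha \<otimes>\<^sub>t T) a' b"
  by (simp add: vec_eq_iff placed_tensor)

text \<open>All placements of the product weight coincide, so a single weighted inner product serves
  every pair of copies.\<close>

lemma placed_tensor_tensor:
  "placed alpha beta (alpha \<otimes>\<^sub>t beta \<otimes>\<^sub>t mu) a b = tensor_power alpha \<otimes>\<^sub>t tensor_power beta \<otimes>\<^sub>t mu"
proof -
  have "beta $ g b $ g' b * (\<Prod>s\<in>UNIV - {b}. beta $ g s $ g' s) = (\<Prod>s\<in>UNIV. beta $ g s $ g' s)" for g g'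
    by (subst prod.remove [of UNIV b]) auto
  then show ?thesis
    by (simp add: vec_eq_iff placed_tensor tensor_power_def tensor_entry_def)
       (simp add: tensor_def tensor_power_def tensor_entry_def mult_ac)
qed

text \<open>
  The left factor acts as the identity on the copy \<open>a'\<close>, so the trace over that copy yields
  the partial trace of \<open>Z\<close>.
\<close>

lemma trace_placed_mult_eq_0:
  fixes P Z :: "('x::finite \<times> 'y::finite \<times> 'm::finite) cmat"
    and a a' :: "'a::finite" and b b' :: "'b::finite"
  assumes "a \<noteq> a'" "ptrace Z = 0"
  shows "trace (placed (mat 1) (mat 1) P a b ** placed alpha beta Z a' b') = 0"
proof -
  have *: "(\<Sum>f\<in>UNIV. \<Sum>f'\<in>UNIV. p (f a) (f' a) * (\<Prod>s\<in>UNIV - {a}. mat 1 $ f s $ f' s) *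
      (z (f' a') (f a') * (\<Prod>s\<in>UNIV - {a'}. alpha $ f' s $ f s))) = 0"
    if z: "(\<Sum>x\<in>UNIV. z x x) = 0" for p z :: "'x \<Rightarrow> 'x \<Rightarrow> complex"
  proof -
    \<comment> \<open>Here \<open>r s\<close> gathers the entries that belong to copy
      \<open>s\<close>. At \<open>a'\<close> the left operator is the identity, so summing
      \<open>r a'\<close> gives the trace of \<open>z\<close>, which is zero.\<close>
    define r where "r s x y = (if s = a then p x y else mat 1 $ x $ y) *
      (if s = a' then z y x else alpha $ y $ x)" for s x y
    have "p (f a) (f' a) * (\<Prod>s\<in>UNIV - {a}. mat 1 $ f s $ f' s) *
        (z (f' a') (f a') * (\<Prod>s\<in>UNIV - {a'}. alpha $ f' s $ f s)) = (\<Prod>s\<in>UNIV. r s (f s) (f' s))" for f f'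
      unfolding r_def prod.distrib
      by (simp only: prod_if_split)
    then have "(\<Sum>f\<in>UNIV. \<Sum>f'\<in>UNIV. p (f a) (f' a) * (\<Prod>s\<in>UNIV - {a}. mat 1 $ f s $ f' s) *
        (z (f' a') (f a') * (\<Prod>s\<in>UNIV - {a'}. alpha $ f' s $ f s))) =
        (\<Sum>f\<in>UNIV. \<Sum>f'\<in>UNIV. \<Prod>s\<in>UNIV. r s (f s) (f' s))"
      by simp
    also have "\<dots> = (\<Prod>s\<in>UNIV. \<Sum>x\<in>UNIV. \<Sum>y\<in>UNIV. r s x y)"
      by (subst sum_prod_fun [of "\<lambda>s. r s (_ s)"]) (rule sum_prod_fun)
    also have "\<dots> = 0"
    proof (rule prod_zero)
      have "r a' x y = (if y = x then z x x else 0)" for x y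
        using \<open>a \<noteq> a'\<close> by (simp add: r_def mat_def)
      then have "(\<Sum>x\<in>UNIV. \<Sum>y\<in>UNIV. r a' x y) = 0"
        using z by simp
      then show "\<exists>s\<in>UNIV. (\<Sum>x\<in>UNIV. \<Sum>y\<in>UNIV. r s x y) = 0"
        by blast
    qed simp
    finally show ?thesis .
  qed
  have Z: "(\<Sum>x\<in>UNIV. Z $ (x, y, m) $ (x, y', m')) = 0" for y y' m m'
    using arg_cong [OF assms(2), of "\<lambda>Q. Q $ (y, m) $ (y', m')"] by (simp add: ptrace_def)
  have inner: "(\<Sum>f\<in>UNIV. \<Sum>f'\<in>UNIV. placed (mat 1) (mat 1) P a b $ (f, g, m) $ (f', g', m') *
      placed alpha beta Z a' b' $ (f', g', m') $ (f, g, m)) = 0" for g m g' m'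
  proof -
    have "(\<Sum>f\<in>UNIV. \<Sum>f'\<in>UNIV. placed (mat 1) (mat 1) P a b $ (f, g, m) $ (f', g', m') *
      placed alpha beta Z a' b' $ (f', g', m') $ (f, g, m)) =
      (\<Sum>f\<in>UNIV. \<Sum>f'\<in>UNIV. P $ (f a, g b, m) $ (f' a, g' b, m') * (\<Prod>s\<in>UNIV - {a}. mat 1 $ f s $ f' s) *
      (Z $ (f' a', g' b', m') $ (f a', g b', m) * (\<Prod>s\<in>UNIV - {a'}. alpha $ f' s $ f s))) *
      ((\<Prod>s\<in>UNIV - {b}. mat 1 $ g s $ g' s) * (\<Prod>s\<in>UNIV - {b'}. beta $ g' s $ g s))"
      by (simp add: placed_nth sum_distrib_left sum_distrib_right mult_ac)
    then show ?thesis
      using * [where p = "\<lambda>x x'. P $ (x, g b, m) $ (x', g' b, m')"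
          and z = "\<lambda>x' x. Z $ (x', g' b', m') $ (x, g b', m)"] Z by simp
  qed
  have "trace (placed (mat 1) (mat 1) P a b ** placed alpha beta Z a' b') =
      (\<Sum>f\<in>UNIV. \<Sum>u\<in>UNIV. \<Sum>f'\<in>UNIV. \<Sum>u'\<in>UNIV. placed (mat 1) (mat 1) P a b $ (f, u) $ (f', u') *
      placed alpha beta Z a' b' $ (f', u') $ (f, u))"
    by (simp add: trace_def matrix_matrix_mult_def sum_UNIV_prod [where 'p = "'a \<Rightarrow> 'x"])
  \<comment> \<open>The sums over the \<open>X\<close> labels are moved innermost, where
    \<open>inner\<close> makes them vanish.\<close>
  also have "\<dots> = (\<Sum>u\<in>UNIV. \<Sum>f\<in>UNIV. \<Sum>f'\<in>UNIV. \<Sum>u'\<in>UNIV. placed (mat 1) (mat 1) P a b $ (f, u) $ (f', u') *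
      placed alpha beta Z a' b' $ (f', u') $ (f, u))"
    by (rule sum.swap)
  also have "\<dots> = (\<Sum>u\<in>UNIV. \<Sum>f\<in>UNIV. \<Sum>u'\<in>UNIV. \<Sum>f'\<in>UNIV. placed (mat 1) (mat 1) P a b $ (f, u) $ (f', u') *
      placed alpha beta Z a' b' $ (f', u') $ (f, u))"
    by (intro sum.cong refl sum.swap)
  also have "\<dots> = (\<Sum>u\<in>UNIV. \<Sum>u'\<in>UNIV. \<Sum>f\<in>UNIV. \<Sum>f'\<in>UNIV. placed (mat 1) (mat 1) P a b $ (f, u) $ (f', u') *
      placed alpha beta Z a' b' $ (f', u') $ (f, u))"
    by (intro sum.cong refl sum.swap)
  also have "\<dots> = 0"
  proof (rule sum.neutral, rule ballI, rule sum.neutral, rule ballI)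
    fix u u' :: "('b \<Rightarrow> 'y) \<times> 'm"
    show "(\<Sum>f\<in>UNIV. \<Sum>f'\<in>UNIV. placed (mat 1) (mat 1) P a b $ (f, u) $ (f', u') *
        placed alpha beta Z a' b' $ (f', u') $ (f, u)) = 0"
      by (cases u, cases u') (simp only: inner)
  qed
  finally show ?thesis .
qed

subsection \<open>Centred operators\<close>

lemma adj_ptrace: "adj (ptrace P) = ptrace (adj P)"
  by (simp add: adj_def ptrace_def vec_eq_iff)

lemma ptrace_swap_tensor: "ptrace (reindex swap_registers (P \<otimes>\<^sub>t Q)) = P \<otimes>\<^sub>t ptrace Q"
  by (simp add: ptrace_def reindex_def tensor_def vec_eq_iff sum_distrib_left)

lemma ptrace_ptrace_swap: "ptrace (ptrace (reindex swap_registers P)) = ptrace (ptrace P)"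
  by (simp add: ptrace_def reindex_def vec_eq_iff) (auto intro: sum.swap)

text \<open>This and the next two facts express the marginals through \<open>ptrace\<close> and the
  swap alone.\<close>

lemma marg_M_eq_ptrace: "marg_M P = ptrace (ptrace P)"
  by (simp add: marg_M_def ptrace_def vec_eq_iff) (auto intro: sum.swap)

lemma marg_YM_eq_ptrace: "marg_YM P = ptrace P"
  by (simp add: marg_YM_def ptrace_def vec_eq_iff)

lemma marg_XM_eq_ptrace: "marg_XM P = ptrace (reindex swap_registers P)"
  by (simp add: marg_XM_def ptrace_def reindex_def vec_eq_iff)

text \<open>The map \<open>center alpha\<close> is \<open>1 - E\<^sub>X\<close>, and
  \<open>center2 beta\<close> is \<open>1 - E\<^sub>Y\<close>, obtained by conjugation with the
  swap.\<close>

definition center :: "('p::finite) cmat \<Rightarrow> ('p \<times> 'r::finite) cmat \<Rightarrow> ('p \<times> 'r) cmat" where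
  "center P Z = Z - P \<otimes>\<^sub>t ptrace Z"

definition center2 :: "('q::finite) cmat \<Rightarrow> ('p::finite \<times> 'q \<times> 'r::finite) cmat \<Rightarrow> ('p \<times> 'q \<times> 'r) cmat" where
  "center2 Q Z = reindex swap_registers (center Q (reindex swap_registers Z))"

lemma center_diff: "center P (Z - Z') = center P Z - center P Z'"
  by (simp add: center_def ptrace_diff tensor_diff_right)

lemma center2_diff: "center2 P (Z - Z') = center2 P Z - center2 P Z'"
  by (simp add: center2_def reindex_diff center_diff)

lemma ptrace_center: "trace P = 1 \<Longrightarrow> ptrace (center P Z) = 0"
  by (simp add: center_def ptrace_diff ptrace_tensor)

lemma ptrace_center2: "trace P = 1 \<Longrightarrow> ptrace (reindex swap_registers (center2 P Z)) = 0"
  by (simp add: center2_def ptrace_center)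

text \<open>The subtracted term has as its trace over the second register \<open>P\<close> tensored
  with the trace of \<open>Z\<close> over both registers, which is zero.\<close>

lemma ptrace_swap_center:
  assumes "ptrace (reindex swap_registers Z) = 0"
  shows "ptrace (reindex swap_registers (center P Z)) = 0"
proof -
  have "ptrace (ptrace Z) = 0"
    using assms by (simp add: ptrace_ptrace_swap [symmetric, of Z]) (simp add: ptrace_def vec_eq_iff)
  then show ?thesis
    using assms by (simp add: center_def reindex_diff ptrace_diff ptrace_swap_tensor)
      (simp add: tensor_def vec_eq_iff)
qed

lemma center_hermitian:
  assumes "adj P = P" "adj Z = Z"
  shows "adj (center P Z) = center P Z"
  using assms by (simp add: center_def adj_diff adj_tensor adj_ptrace)

lemma center2_hermitian:
  assumes "adj P = P" "adj Z = Z"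
  shows "adj (center2 P Z) = center2 P Z"
  using assms by (simp add: center2_def adj_reindex center_hermitian)

text \<open>The factor \<open>2\<close> counts the identity and the contraction that replaces the
  first register by \<open>P\<close>.\<close>

lemma trace_norm_center_le:
  assumes P: "psd P" "trace P = 1" and Z: "adj Z = Z"
  shows "trace_norm (center P Z) \<le> 2 * trace_norm Z"
proof -
  have "trace_norm (P \<otimes>\<^sub>t ptrace Z) \<le> trace_norm Z"
    using P Z by (intro trace_norm_positive_map [where f = "\<lambda>Z. P \<otimes>\<^sub>t ptrace Z"])
      (simp_all add: ptrace_diff tensor_diff_right psd_tensor psd_ptrace trace_tensor trace_ptrace)
  moreover have "trace_norm (center P Z) \<le> trace_norm Z + trace_norm (P \<otimes>\<^sub>t ptrace Z)"
    unfolding center_def using P Z by (intro trace_norm_diff) (simp_all add: adj_tensor adj_ptrace psd_hermitian)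
  ultimately show ?thesis
    by simp
qed

lemma trace_norm_swap_le:
  assumes "adj Z = Z"
  shows "trace_norm (reindex swap_registers Z) \<le> trace_norm Z"
  using assms by (intro trace_norm_positive_map [where f = "reindex swap_registers"])
    (simp_all add: reindex_diff psd_reindex trace_reindex bij_swap_registers)

lemma trace_norm_center2_le:
  assumes P: "psd P" "trace P = 1" and Z: "adj Z = Z"
  shows "trace_norm (center2 P Z) \<le> 2 * trace_norm Z"
proof -
  have "trace_norm (center2 P Z) \<le> trace_norm (center P (reindex swap_registers Z))"
    unfolding center2_def using P Z
    by (intro trace_norm_swap_le center_hermitian) (simp_all add: psd_hermitian adj_reindex)
  also have "\<dots> \<le> 2 * trace_norm (reindex swap_registers Z)"
    using P Z by (intro trace_norm_center_le) (simp_all add: adj_reindex)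
  also have "\<dots> \<le> 2 * trace_norm Z"
    using trace_norm_swap_le [OF Z] by simp
  finally show ?thesis .
qed

lemma second_moment_le_center2:
  assumes "psd alpha" "psd beta" "trace beta = 1" "psd mu"
    and "second_moment_le (alpha \<otimes>\<^sub>t beta \<otimes>\<^sub>t mu) Z t"
  shows "second_moment_le (alpha \<otimes>\<^sub>t beta \<otimes>\<^sub>t mu) (center2 beta Z) t"
proof -
  have "second_moment_le (beta \<otimes>\<^sub>t alpha \<otimes>\<^sub>t mu) (reindex swap_registers Z) t"
    using second_moment_le_reindex [OF bij_swap_registers assms(5)] by (simp add: reindex_swap_tensor)
  then have "second_moment_le (beta \<otimes>\<^sub>t alpha \<otimes>\<^sub>t mu) (center beta (reindex swap_registers Z)) t"
    unfolding center_def using assms by (intro second_moment_le_center psd_tensor)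
  from second_moment_le_reindex [OF bij_swap_registers this] show ?thesis
    by (simp add: reindex_swap_tensor center2_def)
qed

lemma second_moment_le_tensor:
  assumes "psd P" "trace P = 1" "second_moment_le w Z t"
  shows "second_moment_le (P \<otimes>\<^sub>t w) (P \<otimes>\<^sub>t Z) t"
proof -
  obtain L where L: "Z = w ** L" "Re (trace (adj L ** Z)) \<le> t"
    using assms(3) by (auto simp: second_moment_le_def)
  have "P \<otimes>\<^sub>t Z = (P \<otimes>\<^sub>t w) ** (mat 1 \<otimes>\<^sub>t L)"
    using L by (simp add: tensor_mult)
  moreover have "Re (trace (adj (mat 1 \<otimes>\<^sub>t L) ** (P \<otimes>\<^sub>t Z))) \<le> t"
    using L assms by (simp add: adj_tensor tensor_mult trace_tensor)
  ultimately show ?thesis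
    by (auto simp: second_moment_le_def)
qed

subsection \<open>Averages of placed operators\<close>

text \<open>Orthogonality removes the off-diagonal terms of the double sum; at most
  \<open>n * t\<close> remains under the prefactor \<open>1 / n^2\<close>.\<close>

lemma second_moment_le_average:
  assumes "finite I" "I \<noteq> {}"
    and F: "\<And>i. i \<in> I \<Longrightarrow> F i = w ** G i"
    and diag: "\<And>i. i \<in> I \<Longrightarrow> Re (trace (adj (G i) ** F i)) \<le> t"
    and orth: "\<And>i j. i \<in> I \<Longrightarrow> j \<in> I \<Longrightarrow> i \<noteq> j \<Longrightarrow> trace (adj (G i) ** F j) = 0"
  shows "second_moment_le w (inverse (real (card I)) *\<^sub>R (\<Sum>i\<in>I. F i)) (t / card I)"
proof -
  define n where "n = real (card I)"
  have "0 < n"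
    using assms by (simp add: n_def card_gt_0_iff)
  define L where "L = inverse n *\<^sub>R (\<Sum>i\<in>I. G i)"
  define K where "K = inverse n *\<^sub>R (\<Sum>i\<in>I. F i)"
  have "K = w ** L"
    using F by (simp add: K_def L_def scaleR_mult_right matrix_sum_ldistrib)
  have "trace (adj L ** K) = (inverse n)\<^sup>2 *\<^sub>R (\<Sum>i\<in>I. \<Sum>j\<in>I. trace (adj (G j) ** F i))"
    by (simp add: L_def K_def adj_scaleR adj_sum scaleR_mult_left scaleR_mult_right matrix_sum_ldistrib
        matrix_sum_rdistrib trace_scaleR trace_sum power2_eq_square scaleR_sum_right)
  also have "(\<Sum>i\<in>I. \<Sum>j\<in>I. trace (adj (G j) ** F i)) = (\<Sum>i\<in>I. \<Sum>j\<in>I. if j = i then trace (adj (G i) ** F i) else 0)"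
    using orth by (intro sum.cong refl) auto
  also have "\<dots> = (\<Sum>i\<in>I. trace (adj (G i) ** F i))"
    using \<open>finite I\<close> by simp
  finally have "Re (trace (adj L ** K)) = (inverse n)\<^sup>2 * (\<Sum>i\<in>I. Re (trace (adj (G i) ** F i)))"
    by simp
  also have "\<dots> \<le> (inverse n)\<^sup>2 * (n * t)"
    using sum_mono [of I "\<lambda>i. Re (trace (adj (G i) ** F i))" "\<lambda>_. t"] diag
    by (intro mult_left_mono) (simp_all add: n_def)
  also have "\<dots> = t / n"
    using \<open>0 < n\<close> by (simp add: power2_eq_square field_simps)
  finally show ?thesis
    using \<open>K = w ** L\<close> by (auto simp: second_moment_le_def K_def n_def)
qed

lemma trace_placed_mult_swap_eq_0:
  assumes "b \<noteq> b'" "ptrace (reindex swap_registers Z) = 0"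
  shows "trace (placed (mat 1) (mat 1) P a b ** placed alpha beta Z a' b') = 0"
proof -
  have swap: "placed gamma delta Q c d = reindex swap_registers (placed delta gamma (reindex swap_registers Q) d c)"
    for gamma delta Q c d
    using placed_swap [of gamma delta "reindex swap_registers Q" c d] by simp
  show ?thesis
    unfolding swap [of _ _ P] swap [of _ _ Z]
    using trace_placed_mult_eq_0 [OF assms]
    by (simp add: reindex_mult [OF bij_swap_registers, symmetric] trace_reindex [OF bij_swap_registers])
qed

text \<open>The index set \<open>I\<close> is general so as to cover both the full grid of pairs,
  for operators centred in both registers, and a single row of copies, for operators centred in
  one.\<close>

lemma trace_norm_average_placed_le:
  fixes Z :: "('x::finite \<times> 'y::finite \<times> 'm::finite) cmat" and I :: "('a::finite \<times> 'b::finite) set"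
  assumes alpha: "psd alpha" "trace alpha = 1" and beta: "psd beta" "trace beta = 1" and mu: "psd mu"
    and Z: "adj Z = Z" "second_moment_le (alpha \<otimes>\<^sub>t beta \<otimes>\<^sub>t mu) Z t"
    and "I \<noteq> {}"
    and orth: "\<And>a b a' b'. (a, b) \<in> I \<Longrightarrow> (a', b') \<in> I \<Longrightarrow> (a, b) \<noteq> (a', b') \<Longrightarrow>
      a \<noteq> a' \<and> ptrace Z = 0 \<or> b \<noteq> b' \<and> ptrace (reindex swap_registers Z) = 0"
  shows "trace_norm (inverse (real (card I)) *\<^sub>R (\<Sum>(a, b)\<in>I. placed alpha beta Z a b)) \<le>
    sqrt (Re (trace mu) * (t / card I))"
proof -
  let ?w = "tensor_power alpha \<otimes>\<^sub>t tensor_power beta \<otimes>\<^sub>t mu :: (('a \<Rightarrow> 'x) \<times> ('b \<Rightarrow> 'y) \<times> 'm) cmat"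
  have w: "?w = placed alpha beta (alpha \<otimes>\<^sub>t beta \<otimes>\<^sub>t mu) a b" for a b
    by (simp add: placed_tensor_tensor)
  have psd_w: "psd ?w"
    unfolding w [of undefined undefined] using alpha beta mu by (intro psd_placed psd_tensor)
  have trace_w: "trace ?w = trace mu"
    unfolding w [of undefined undefined] using alpha beta by (simp add: trace_placed trace_tensor)
  obtain L where L: "Z = (alpha \<otimes>\<^sub>t beta \<otimes>\<^sub>t mu) ** L" "Re (trace (adj L ** Z)) \<le> t"
    using Z(2) by (auto simp: second_moment_le_def)
  let ?F = "\<lambda>(a, b). placed alpha beta Z a b :: (('a \<Rightarrow> 'x) \<times> ('b \<Rightarrow> 'y) \<times> 'm) cmat"
  \<comment> \<open>The fillers \<open>alpha\<close> and \<open>beta\<close> belong to the weight,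
    so dividing by it leaves identities on the other copies.\<close>
  let ?G = "\<lambda>(a, b). placed (mat 1) (mat 1) L a b :: (('a \<Rightarrow> 'x) \<times> ('b \<Rightarrow> 'y) \<times> 'm) cmat"
  have "second_moment_le ?w (inverse (real (card I)) *\<^sub>R (\<Sum>i\<in>I. ?F i)) (t / card I)"
  proof (rule second_moment_le_average [where G = ?G])
    fix i assume "i \<in> I"
    obtain a b where i: "i = (a, b)"
      by (cases i)
    show "?F i = ?w ** ?G i"
      unfolding w [of a b] i by (simp add: placed_mult L(1) [symmetric])
    show "Re (trace (adj (?G i) ** ?F i)) \<le> t"
      unfolding i using alpha beta L(2) by (simp add: adj_placed placed_mult trace_placed)
  next
    fix i j assume ij: "i \<in> I" "j \<in> I" "i \<noteq> j"
    obtain a b a' b' where "i = (a, b)" "j = (a', b')"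
      by (cases i, cases j)
    then show "trace (adj (?G i) ** ?F j) = 0"
      using orth [of a b a' b'] ij
      by (auto simp: adj_placed trace_placed_mult_eq_0 trace_placed_mult_swap_eq_0)
  qed (use \<open>I \<noteq> {}\<close> in auto)
  note moment = this
  have "adj (inverse (real (card I)) *\<^sub>R (\<Sum>i\<in>I. ?F i)) = inverse (real (card I)) *\<^sub>R (\<Sum>i\<in>I. ?F i)"
    using alpha beta Z by (simp add: adj_scaleR adj_sum case_prod_unfold adj_placed psd_hermitian)
  from trace_norm_le_second_moment [OF psd_w this moment] show ?thesis
    by (simp only: trace_w)
qed

section \<open>Averages over all pairs of copies\<close>

definition avg_placed ::
    "('x::finite) cmat \<Rightarrow> ('y::finite) cmat \<Rightarrow> ('x \<times> 'y \<times> 'm::finite) cmat \<Rightarrow>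
     (('a::finite \<Rightarrow> 'x) \<times> ('b::finite \<Rightarrow> 'y) \<times> 'm) cmat" where
  "avg_placed alpha beta Z =
     inverse (real (CARD('a) * CARD('b))) *\<^sub>R (\<Sum>a\<in>(UNIV :: 'a set). \<Sum>b\<in>(UNIV :: 'b set). placed alpha beta Z a b)"

lemma avg_placed_diff: "avg_placed alpha beta (P - Q) = avg_placed alpha beta P - avg_placed alpha beta Q"
  by (simp add: avg_placed_def placed_diff sum_subtractf scaleR_diff_right)

lemma psd_avg_placed: "psd alpha \<Longrightarrow> psd beta \<Longrightarrow> psd P \<Longrightarrow> psd (avg_placed alpha beta P)"
  unfolding avg_placed_def by (intro psd_scaleR psd_sum psd_placed) auto

lemma trace_avg_placed:
  assumes "trace alpha = 1" "trace beta = 1"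
  shows "trace (avg_placed alpha beta P) = trace P"
  using assms by (simp add: avg_placed_def trace_scaleR trace_sum trace_placed scaleR_conv_of_real [where 'a = complex] divide_simps)

lemma trace_norm_avg_placed_le:
  assumes "psd alpha" "trace alpha = 1" "psd beta" "trace beta = 1" "adj Z = Z"
  shows "trace_norm (avg_placed alpha beta Z) \<le> trace_norm Z"
  using assms by (intro trace_norm_positive_map [where f = "avg_placed alpha beta"])
    (simp_all add: avg_placed_diff psd_avg_placed trace_avg_placed)

lemma avg_placed_hermitian:
  assumes "psd alpha" "psd beta" "adj Z = Z"
  shows "adj (avg_placed alpha beta Z) = avg_placed alpha beta Z"
  using assms by (simp add: avg_placed_def adj_scaleR adj_sum adj_placed psd_hermitian)

text \<open>Thus \<open>tau\<close> is an average of placements too, and \<open>sigma - tau\<close>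
  is the image of \<open>rho\<close> minus the product weight.\<close>

lemma avg_placed_tensor_tensor:
  "avg_placed alpha beta (alpha \<otimes>\<^sub>t beta \<otimes>\<^sub>t mu) = tensor_power alpha \<otimes>\<^sub>t tensor_power beta \<otimes>\<^sub>t mu"
  by (simp add: avg_placed_def placed_tensor_tensor sum_constant_scaleR divide_simps del: sum_constant)

text \<open>Distinct pairs differ in some coordinate and the operator is centred in both registers,
  so all \<open>CARD('a) * CARD('b)\<close> placements are mutually orthogonal.\<close>

lemma trace_norm_avg_center_center2_le:
  fixes Z :: "('x::finite \<times> 'y::finite \<times> 'm::finite) cmat"
  assumes alpha: "psd alpha" "trace alpha = 1" and beta: "psd beta" "trace beta = 1" and mu: "psd mu"
    and Z: "adj Z = Z" "second_moment_le (alpha \<otimes>\<^sub>t beta \<otimes>\<^sub>t mu) Z t"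
  shows "trace_norm (avg_placed alpha beta (center alpha (center2 beta Z)) ::
      (('a::finite \<Rightarrow> 'x) \<times> ('b::finite \<Rightarrow> 'y) \<times> 'm) cmat) \<le>
    sqrt (Re (trace mu) * (t / (real CARD('a) * real CARD('b))))"
proof -
  let ?Z = "center alpha (center2 beta Z)"
  have "second_moment_le (alpha \<otimes>\<^sub>t beta \<otimes>\<^sub>t mu) ?Z t"
    unfolding center_def [of alpha] using alpha beta mu Z(2)
    by (intro second_moment_le_center second_moment_le_center2 psd_tensor)
  moreover have "adj ?Z = ?Z"
    using alpha beta Z by (simp add: center_hermitian center2_hermitian psd_hermitian)
  moreover have "ptrace ?Z = 0" "ptrace (reindex swap_registers ?Z) = 0"
    using alpha beta by (simp_all add: ptrace_center ptrace_swap_center ptrace_center2)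
  ultimately have "trace_norm (inverse (real CARD('a \<times> 'b)) *\<^sub>R
      (\<Sum>(a :: 'a, b :: 'b)\<in>UNIV. placed alpha beta ?Z a b)) \<le> sqrt (Re (trace mu) * (t / CARD('a \<times> 'b)))"
    by (intro trace_norm_average_placed_le alpha beta mu) auto
  then show ?thesis
    by (simp add: avg_placed_def sum_UNIV_prod)
qed

text \<open>With \<open>beta\<close> in the \<open>Y\<close> slot the placement does not depend on
  \<open>b\<close>, so the average runs over \<open>CARD('a)\<close> mutually orthogonal
  placements.\<close>

lemma trace_norm_avg_center_le:
  fixes S :: "('x::finite \<times> 'm::finite) cmat" and beta :: "('y::finite) cmat"
  assumes alpha: "psd alpha" "trace alpha = 1" and beta: "psd beta" "trace beta = 1" and mu: "psd mu"
    and S: "adj S = S" "second_moment_le (alpha \<otimes>\<^sub>t mu) S t"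
  shows "trace_norm (avg_placed alpha beta (center alpha (reindex swap_registers (beta \<otimes>\<^sub>t S))) ::
      (('a::finite \<Rightarrow> 'x) \<times> ('b::finite \<Rightarrow> 'y) \<times> 'm) cmat) \<le>
    sqrt (Re (trace mu) * (t / real CARD('a)))"
proof -
  let ?Z = "center alpha (reindex swap_registers (beta \<otimes>\<^sub>t S))"
  \<comment> \<open>The element \<open>undefined\<close> is an arbitrary representative of the
    \<open>Y\<close> copies.\<close>
  let ?I = "(UNIV :: 'a set) \<times> {undefined :: 'b}"
  have Z: "?Z = reindex swap_registers (beta \<otimes>\<^sub>t (S - alpha \<otimes>\<^sub>t ptrace S))"
    by (simp add: center_def ptrace_swap_tensor tensor_diff_right reindex_diff reindex_swap_tensor)
  have indep: "placed alpha beta ?Z a b = placed alpha beta ?Z a undefined" for a :: 'a and b :: 'b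
    unfolding Z placed_swap by (rule arg_cong [OF placed_tensor_indep])
  have "second_moment_le (alpha \<otimes>\<^sub>t beta \<otimes>\<^sub>t mu) (reindex swap_registers (beta \<otimes>\<^sub>t S)) t"
    using second_moment_le_reindex [OF bij_swap_registers second_moment_le_tensor [OF beta S(2)]]
    by (simp add: reindex_swap_tensor)
  then have "second_moment_le (alpha \<otimes>\<^sub>t beta \<otimes>\<^sub>t mu) ?Z t"
    unfolding center_def using alpha beta mu by (intro second_moment_le_center psd_tensor)
  moreover have "adj ?Z = ?Z"
    using alpha beta S by (simp add: center_hermitian adj_reindex adj_tensor psd_hermitian)
  moreover have "ptrace ?Z = 0"
    using alpha by (simp add: ptrace_center)
  ultimately have "trace_norm (inverse (real (card ?I)) *\<^sub>R (\<Sum>(a, b)\<in>?I. placed alpha beta ?Z a b)) \<le>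
      sqrt (Re (trace mu) * (t / card ?I))"
    by (intro trace_norm_average_placed_le alpha beta mu) auto
  moreover have "(\<Sum>(a, b)\<in>?I. placed alpha beta ?Z a b) = (\<Sum>a\<in>UNIV. placed alpha beta ?Z a undefined)"
    by (simp add: sum.cartesian_product [symmetric])
  moreover have "(avg_placed alpha beta ?Z :: (('a \<Rightarrow> 'x) \<times> ('b \<Rightarrow> 'y) \<times> 'm) cmat) =
      inverse (real CARD('a)) *\<^sub>R (\<Sum>a\<in>UNIV. placed alpha beta ?Z a (undefined :: 'b))"
  proof -
    have "(\<Sum>b\<in>(UNIV :: 'b set). placed alpha beta ?Z a b) = real CARD('b) *\<^sub>R placed alpha beta ?Z a undefined"
      for a :: 'a
    proof -
      have "(\<Sum>b\<in>(UNIV :: 'b set). placed alpha beta ?Z a b) = (\<Sum>b\<in>(UNIV :: 'b set). placed alpha beta ?Z a undefined)"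
        by (rule sum.cong [OF refl indep])
      then show ?thesis
        by (simp add: sum_constant_scaleR del: sum_constant)
    qed
    then show ?thesis
      by (simp add: avg_placed_def scaleR_sum_right [symmetric])
  qed
  ultimately show ?thesis
    by (simp add: card_cartesian_product)
qed

text \<open>The preceding bound with the registers \<open>X\<close> and \<open>Y\<close>
  exchanged.\<close>

lemma trace_norm_avg_center2_le:
  fixes T :: "('y::finite \<times> 'm::finite) cmat" and alpha :: "('x::finite) cmat"
  assumes alpha: "psd alpha" "trace alpha = 1" and beta: "psd beta" "trace beta = 1" and mu: "psd mu"
    and T: "adj T = T" "second_moment_le (beta \<otimes>\<^sub>t mu) T t"
  shows "trace_norm (avg_placed alpha beta (center2 beta (alpha \<otimes>\<^sub>t T)) ::
      (('a::finite \<Rightarrow> 'x) \<times> ('b::finite \<Rightarrow> 'y) \<times> 'm) cmat) \<le>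
    sqrt (Re (trace mu) * (t / real CARD('b)))"
proof -
  have "avg_placed alpha beta (center2 beta (alpha \<otimes>\<^sub>t T)) =
      reindex swap_registers (avg_placed beta alpha (center beta (reindex swap_registers (alpha \<otimes>\<^sub>t T))) ::
        (('b \<Rightarrow> 'y) \<times> ('a \<Rightarrow> 'x) \<times> 'm) cmat)"
  proof -
    have "reindex swap_registers (\<Sum>b\<in>UNIV. \<Sum>a\<in>UNIV. F b a :: (('b \<Rightarrow> 'y) \<times> ('a \<Rightarrow> 'x) \<times> 'm) cmat) =
        (\<Sum>a\<in>(UNIV :: 'a set). \<Sum>b\<in>(UNIV :: 'b set). reindex swap_registers (F b a))" for F
      by (simp add: reindex_def vec_eq_iff) (auto intro: sum.swap)
    moreover have "reindex swap_registers (c *\<^sub>R P) = c *\<^sub>R reindex swap_registers P"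
      for c and P :: "(('b \<Rightarrow> 'y) \<times> ('a \<Rightarrow> 'x) \<times> 'm) cmat"
      by (simp add: reindex_def vec_eq_iff)
    ultimately show ?thesis
      by (simp add: avg_placed_def center2_def placed_swap mult.commute)
  qed
  also have "trace_norm \<dots> \<le> trace_norm (avg_placed beta alpha (center beta (reindex swap_registers (alpha \<otimes>\<^sub>t T))) ::
        (('b \<Rightarrow> 'y) \<times> ('a \<Rightarrow> 'x) \<times> 'm) cmat)"
    using alpha beta T by (intro trace_norm_swap_le avg_placed_hermitian center_hermitian)
      (simp_all add: psd_hermitian adj_reindex adj_tensor)
  also have "\<dots> \<le> sqrt (Re (trace mu) * (t / real CARD('b)))"
    using assms by (intro trace_norm_avg_center_le)
  finally show ?thesis .
qed

subsection \<open>Soft covering\<close>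

text \<open>With \<open>e = eps powr (1 / 64)\<close>, the margin in the rate contributes
  \<open>e powr (16 / 5)\<close>, at most \<open>e^2 / 5\<close>. The square root turns
  \<open>e^2\<close> into \<open>e\<close>, and the spare \<open>1 / 5\<close> absorbs the possible
  growth of the trace under smoothing.\<close>

lemma smoothed_second_moment:
  assumes P: "psd P" and Q: "psd Q" and eps: "0 < eps" "eps powr (1 / 64) \<le> 1 / 5" and "0 < n"
    and rate: "D_inf_smooth eps P Q + ereal (log 2 (eps powr (- 1 / 20))) < ereal (log 2 n)"
  obtains R t where "psd R" "trace_norm (P - R) \<le> eps * Re (trace P)" "second_moment_le Q R t"
    "sqrt (Re (trace P) * (t / n)) \<le> eps powr (1 / 64) * Re (trace P)"
proof -
  define e where "e = eps powr (1 / 64)"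
  define p where "p = Re (trace P)"
  have p: "0 \<le> p"
    using psd_trace_nonneg P by (simp add: p_def)
  have e: "0 < e" "e \<le> 1 / 5"
    using eps by (simp_all add: e_def)
  have e_powr: "e powr x = eps powr (x / 64)" for x
    by (simp add: e_def powr_powr)
  have eps_le: "eps \<le> 1"
  proof -
    have "eps = e powr 64"
      using eps by (simp add: e_powr)
    also have "\<dots> \<le> 1"
      using e by (intro powr_le1) auto
    finally show ?thesis .
  qed
  have c: "0 < eps powr (- 1 / 20)"
    using eps by simp
  obtain R where R: "psd R" "trace_norm (R - P) \<le> eps * Re (trace P)"
    "second_moment_le Q R (n / eps powr (- 1 / 20) * Re (trace R))"
    using D_inf_smooth_second_moment [OF Q \<open>0 < n\<close> c rate] by blast
  have herm: "adj (R - P) = R - P"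
    using R P by (simp add: adj_diff psd_hermitian)
  \<comment> \<open>Smoothing changes the trace by no more than the trace distance.\<close>
  have "Re (trace R) \<le> p + eps * p"
    using abs_trace_le_trace_norm [OF herm] R(2) by (simp add: trace_sub p_def)
  also have "\<dots> \<le> 2 * p"
    using mult_right_mono [OF eps_le p] by simp
  finally have tr: "Re (trace R) \<le> 2 * p" .
  \<comment> \<open>The exponent is \<open>64 / 20 = 16 / 5\<close>.\<close>
  have "1 / eps powr (- 1 / 20) = e powr (16 / 5)"
    by (simp add: e_powr powr_minus field_simps)
  also have "\<dots> \<le> e powr 3"
    using e by (intro powr_mono') auto
  also have "\<dots> \<le> e\<^sup>2 / 5"
  proof -
    have "e powr 3 = e\<^sup>2 * e"
      using e by (simp add: powr_numeral power2_eq_square power3_eq_cube)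
    also have "\<dots> \<le> e\<^sup>2 * (1 / 5)"
      using e by (intro mult_left_mono) auto
    finally show ?thesis
      by simp
  qed
  finally have c_le: "1 / eps powr (- 1 / 20) \<le> e\<^sup>2 / 5" .
  have "p * (n / eps powr (- 1 / 20) * Re (trace R) / n) = p * (1 / eps powr (- 1 / 20) * Re (trace R))"
    using \<open>0 < n\<close> by simp
  also have "\<dots> \<le> p * (e\<^sup>2 / 5 * (2 * p))"
    using c_le tr p psd_trace_nonneg [OF R(1)] by (intro mult_left_mono mult_mono) auto
  also have "\<dots> = 2 / 5 * (e * p)\<^sup>2"
    by (simp add: power2_eq_square)
  also have "\<dots> \<le> 1 * (e * p)\<^sup>2"
    by (intro mult_right_mono) auto
  finally have "p * (n / eps powr (- 1 / 20) * Re (trace R) / n) \<le> (e * p)\<^sup>2"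
    by (simp only: mult_1)
  then have "sqrt (p * (n / eps powr (- 1 / 20) * Re (trace R) / n)) \<le> sqrt ((e * p)\<^sup>2)"
    by (rule real_sqrt_le_mono)
  also have "\<dots> = e * p"
    using e p by simp
  finally have "sqrt (p * (n / eps powr (- 1 / 20) * Re (trace R) / n)) \<le> e * p" .
  moreover have "trace_norm (P - R) \<le> eps * p"
    using trace_norm_minus [OF herm] R(2) by (simp add: p_def)
  ultimately show thesis
    using that [OF R(1) _ R(3)] unfolding p_def e_def by blast
qed

text \<open>The map \<open>f\<close> stands for a centring with trace norm bound \<open>c\<close>.
  Replacing \<open>P\<close> by its smoothing inside \<open>f\<close> costs \<open>c * d\<close>,
  since averaging over placements contracts the trace norm.\<close>

lemma trace_norm_avg_le_of_approximation:
  fixes f :: "('x::finite \<times> 'y::finite \<times> 'm::finite) cmat \<Rightarrow> ('x \<times> 'y \<times> 'm) cmat"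
  assumes alpha: "psd alpha" "trace alpha = 1" and beta: "psd beta" "trace beta = 1"
    and f_diff: "\<And>U V. f (U - V) = f U - f V"
    and f_herm: "\<And>U. adj U = U \<Longrightarrow> adj (f U) = f U"
    and f_le: "\<And>U. adj U = U \<Longrightarrow> trace_norm (f U) \<le> c * trace_norm U" and "0 \<le> c"
    and P: "adj P = P" and R: "adj R = R" and close: "trace_norm (P - R) \<le> d"
    and avg: "trace_norm (avg_placed alpha beta (f R) :: (('a::finite \<Rightarrow> 'x) \<times> ('b::finite \<Rightarrow> 'y) \<times> 'm) cmat) \<le> s"
  shows "trace_norm (avg_placed alpha beta (f P) :: (('a \<Rightarrow> 'x) \<times> ('b \<Rightarrow> 'y) \<times> 'm) cmat) \<le> s + c * d"
proof -
  let ?avg = "avg_placed alpha beta :: _ \<Rightarrow> (('a \<Rightarrow> 'x) \<times> ('b \<Rightarrow> 'y) \<times> 'm) cmat"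
  have herm: "adj (P - R) = P - R"
    using P R by (simp add: adj_diff)
  have "trace_norm (?avg (f (P - R))) \<le> trace_norm (f (P - R))"
    using alpha beta herm by (intro trace_norm_avg_placed_le f_herm)
  also have "\<dots> \<le> c * trace_norm (P - R)"
    by (rule f_le [OF herm])
  also have "\<dots> \<le> c * d"
    using close \<open>0 \<le> c\<close> by (rule mult_left_mono)
  finally have "trace_norm (?avg (f (P - R))) \<le> c * d" .
  moreover have split: "?avg (f P) = ?avg (f R) + ?avg (f (P - R))"
    by (simp add: f_diff avg_placed_diff)
  moreover have "trace_norm (?avg (f R) + ?avg (f (P - R))) \<le> trace_norm (?avg (f R)) + trace_norm (?avg (f (P - R)))"
    using alpha beta P R herm by (intro trace_norm_add avg_placed_hermitian f_herm)
  ultimately show ?thesis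
    unfolding split using avg by linarith
qed

lemma trace_norm_tensor_le:
  assumes "psd P" "trace P = 1" "adj Z = Z"
  shows "trace_norm (P \<otimes>\<^sub>t Z) \<le> trace_norm Z"
  using assms by (intro trace_norm_positive_map [where f = "\<lambda>Z. P \<otimes>\<^sub>t Z"])
    (simp_all add: tensor_diff_right psd_tensor trace_tensor)

theorem lemma7:
  fixes eps :: real
    and rho :: "('x::finite \<times> 'y::finite \<times> 'm::finite) cmat"
    and alpha :: "'x cmat"
    and beta :: "'y cmat"
    and sigma tau :: "(('a::finite \<Rightarrow> 'x) \<times> ('b::finite \<Rightarrow> 'y) \<times> 'm) cmat"
    and A B :: nat
  assumes eps: "0 < eps" "eps < 1"
    and rho: "subnormalised rho" "rho \<noteq> 0"
    and alpha: "normalised alpha" "supp (marg_X rho) \<subseteq> supp alpha"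
    and beta: "normalised beta" "supp (marg_Y rho) \<subseteq> supp beta"
    and A: "A = CARD('a)"
    and B: "B = CARD('b)"
    and sigma: "sigma =
      inverse (real (A * B)) *\<^sub>R (\<Sum>a\<in>UNIV. \<Sum>b\<in>UNIV. placed alpha beta rho a b)"
    and tau: "tau = tensor_power alpha \<otimes>\<^sub>t tensor_power beta \<otimes>\<^sub>t marg_M rho"
    and rate_X: "ereal (log 2 (real A)) >
      D_inf_smooth eps (marg_XM rho) (alpha \<otimes>\<^sub>t marg_M rho)
        + ereal (log 2 (eps powr (- 1 / 20)))"
    and rate_Y: "ereal (log 2 (real B)) >
      D_inf_smooth eps (marg_YM rho) (beta \<otimes>\<^sub>t marg_M rho)
        + ereal (log 2 (eps powr (- 1 / 20)))"
    and rate_XY: "ereal (log 2 (real A) + log 2 (real B)) >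
      D_inf_smooth eps rho (alpha \<otimes>\<^sub>t beta \<otimes>\<^sub>t marg_M rho)
        + ereal (log 2 (eps powr (- 1 / 20)))"
  shows "trace_norm (sigma - tau) < 10 * eps powr (1 / 64) * Re (trace rho)"
proof -
  define mu where "mu = marg_M rho"
  define p where "p = Re (trace rho)"
  define e where "e = eps powr (1 / 64)"
  let ?avg = "avg_placed alpha beta :: _ \<Rightarrow> (('a \<Rightarrow> 'x) \<times> ('b \<Rightarrow> 'y) \<times> 'm) cmat"
  have psd_rho: "psd rho"
    using rho by (simp add: subnormalised_def)
  have a: "psd alpha" "trace alpha = 1" and b: "psd beta" "trace beta = 1"
    using alpha beta by (simp_all add: normalised_def)
  have mu: "psd mu" "trace mu = trace rho"
    using psd_rho by (simp_all add: mu_def marg_M_eq_ptrace psd_ptrace trace_ptrace)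
  \<comment> \<open>Positivity of the trace is what makes the final inequality strict; at
    \<open>rho = 0\<close> both sides would be zero.\<close>
  have "0 < p"
    using psd_Re_trace_eq_0 [OF psd_rho] rho(2) psd_trace_nonneg [OF psd_rho] by (force simp: p_def)
  have "0 < e"
    using eps by (simp add: e_def)
  have sigma_avg: "sigma = ?avg rho"
    by (simp add: sigma avg_placed_def A B)
  have tau_avg: "tau = ?avg (alpha \<otimes>\<^sub>t beta \<otimes>\<^sub>t mu)"
    by (simp add: tau mu_def avg_placed_tensor_tensor)
  show ?thesis
  proof (cases "e \<le> 1 / 5")
    \<comment> \<open>Here \<open>2 < 10 * e\<close>, so the triangle inequality suffices.\<close>
    case False
    have "trace_norm (sigma - tau) \<le> Re (trace sigma) + Re (trace tau)"
      unfolding sigma_avg tau_avg using a b mu psd_rho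
      by (intro trace_norm_diff_le psd_avg_placed psd_tensor)
    also have "\<dots> = 2 * p"
      unfolding sigma_avg tau_avg using a b mu by (simp add: trace_avg_placed trace_tensor p_def)
    also have "\<dots> < 10 * e * p"
      using False \<open>0 < p\<close> by simp
    finally show ?thesis
      by (simp add: e_def p_def)
  next
    case True
    then have e5: "eps powr (1 / 64) \<le> 1 / 5"
      by (simp add: e_def)
    define rXM where "rXM = ptrace (reindex swap_registers rho)"
    define rYM where "rYM = ptrace rho"
    have psd_XM: "psd rXM" and psd_YM: "psd rYM"
      using psd_rho by (simp_all add: rXM_def rYM_def psd_ptrace psd_reindex bij_swap_registers)
    have tr_XM: "trace rXM = trace rho" and tr_YM: "trace rYM = trace rho"
      by (simp_all add: rXM_def rYM_def trace_ptrace trace_reindex bij_swap_registers)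
    have pt_XM: "ptrace rXM = mu" and pt_YM: "ptrace rYM = mu"
      by (simp_all add: rXM_def rYM_def mu_def marg_M_eq_ptrace ptrace_ptrace_swap)
    have AB: "0 < real A" "0 < real B"
      by (simp_all add: A B)
    obtain S s where S: "psd S" "trace_norm (rXM - S) \<le> eps * p" "second_moment_le (alpha \<otimes>\<^sub>t mu) S s"
      "sqrt (p * (s / real A)) \<le> e * p"
      using smoothed_second_moment [OF psd_XM psd_tensor [OF a(1) mu(1)] eps(1) e5 AB(1)] rate_X
      by (metis marg_XM_eq_ptrace mu_def rXM_def tr_XM p_def e_def)
    obtain T t where T: "psd T" "trace_norm (rYM - T) \<le> eps * p" "second_moment_le (beta \<otimes>\<^sub>t mu) T t"
      "sqrt (p * (t / real B)) \<le> e * p"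
      using smoothed_second_moment [OF psd_YM psd_tensor [OF b(1) mu(1)] eps(1) e5 AB(2)] rate_Y
      by (metis marg_YM_eq_ptrace mu_def rYM_def tr_YM p_def e_def)
    have "D_inf_smooth eps rho (alpha \<otimes>\<^sub>t beta \<otimes>\<^sub>t mu) + ereal (log 2 (eps powr (- 1 / 20)))
        < ereal (log 2 (real A * real B))"
      using rate_XY AB by (simp add: log_mult mu_def)
    then obtain R r where R: "psd R" "trace_norm (rho - R) \<le> eps * p"
      "second_moment_le (alpha \<otimes>\<^sub>t beta \<otimes>\<^sub>t mu) R r" "sqrt (p * (r / (real A * real B))) \<le> e * p"
      using smoothed_second_moment [OF psd_rho psd_tensor [OF a(1) psd_tensor [OF b(1) mu(1)]] eps(1) e5, of "real A * real B"] AB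
      by (metis mult_pos_pos p_def e_def)
    \<comment> \<open>These are \<open>E\<^sub>X rho\<close> and \<open>E\<^sub>Y rho\<close>; the
      swap puts \<open>beta\<close> back into the second slot.\<close>
    define PX where "PX = alpha \<otimes>\<^sub>t rYM"
    define PY where "PY = reindex swap_registers (beta \<otimes>\<^sub>t rXM)"
    have herm: "adj rho = rho" "adj S = S" "adj T = T" "adj R = R" "adj alpha = alpha" "adj beta = beta"
      "adj rXM = rXM" "adj rYM = rYM"
      using psd_rho S T R a b psd_XM psd_YM psd_hermitian by blast+
    have hermP: "adj PX = PX" "adj PY = PY"
      using herm by (simp_all add: PX_def PY_def adj_tensor adj_reindex)
    have c1: "center alpha (center2 beta rho) = rho - PY - PX + alpha \<otimes>\<^sub>t beta \<otimes>\<^sub>t mu"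
      using pt_XM
      by (simp add: center2_def center_def PX_def PY_def reindex_diff ptrace_diff ptrace_swap_tensor
          tensor_diff_right rXM_def [symmetric] rYM_def [symmetric])
    have c2: "center alpha PY = PY - alpha \<otimes>\<^sub>t beta \<otimes>\<^sub>t mu"
      using pt_XM by (simp add: center_def PY_def ptrace_swap_tensor)
    have c3: "center2 beta PX = PX - alpha \<otimes>\<^sub>t beta \<otimes>\<^sub>t mu"
      using pt_YM by (simp add: center2_def center_def PX_def ptrace_swap_tensor reindex_diff reindex_swap_tensor)
    \<comment> \<open>Sums are written as differences from \<open>0\<close>, the form in which
      \<open>avg_placed_diff\<close> applies.\<close>
    have "rho - alpha \<otimes>\<^sub>t beta \<otimes>\<^sub>t mu =
        center alpha (center2 beta rho) - (0 - center alpha PY) - (0 - center2 beta PX)"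
      by (simp add: c1 c2 c3)
    then have "?avg rho - ?avg (alpha \<otimes>\<^sub>t beta \<otimes>\<^sub>t mu) =
        ?avg (center alpha (center2 beta rho)) - (?avg 0 - ?avg (center alpha PY)) - (?avg 0 - ?avg (center2 beta PX))"
      by (metis avg_placed_diff)
    moreover have "?avg 0 = 0"
      using avg_placed_diff [of alpha beta 0 0] by simp
    ultimately have split: "sigma - tau =
        ?avg (center alpha (center2 beta rho)) + ?avg (center alpha PY) + ?avg (center2 beta PX)"
      by (simp add: sigma_avg tau_avg)
    \<comment> \<open>The cost factor is \<open>4 = 2 * 2\<close>, one factor \<open>2\<close> for
      each centring.\<close>
    have b1: "trace_norm (?avg (center alpha (center2 beta rho))) \<le> e * p + 4 * (eps * p)"
    proof (rule trace_norm_avg_le_of_approximation [where R = R and f = "\<lambda>Z. center alpha (center2 beta Z)"])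
      show "trace_norm (center alpha (center2 beta U)) \<le> 4 * trace_norm U" if "adj U = U" for U
        using trace_norm_center_le [OF a, of "center2 beta U"] trace_norm_center2_le [OF b that]
          center2_hermitian [OF herm(6) that] by simp
      show "trace_norm (?avg (center alpha (center2 beta R))) \<le> e * p"
        using trace_norm_avg_center_center2_le [OF a b mu(1) herm(4) R(3), where 'a = 'a and 'b = 'b] R(4)
        by (simp add: A B mu(2) p_def)
    qed (use a b R herm in \<open>simp_all add: center_diff center2_diff center_hermitian center2_hermitian\<close>)
    \<comment> \<open>Only the marginal on \<open>X\<close> and \<open>M\<close> is smoothed here;
      tensoring with \<open>beta\<close> and swapping do not enlarge the error, and the single
      centring doubles it.\<close>
    have b2: "trace_norm (?avg (center alpha PY)) \<le> e * p + 2 * (eps * p)"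
    proof (rule trace_norm_avg_le_of_approximation [where f = "center alpha" and R = "reindex swap_registers (beta \<otimes>\<^sub>t S)"])
      have d: "adj (rXM - S) = rXM - S"
        using herm by (simp add: adj_diff)
      have "trace_norm (reindex swap_registers (beta \<otimes>\<^sub>t (rXM - S))) \<le> trace_norm (beta \<otimes>\<^sub>t (rXM - S))"
        using d herm by (intro trace_norm_swap_le) (simp add: adj_tensor)
      also have "\<dots> \<le> trace_norm (rXM - S)"
        by (rule trace_norm_tensor_le [OF b d])
      finally show "trace_norm (PY - reindex swap_registers (beta \<otimes>\<^sub>t S)) \<le> eps * p"
        using S(2) by (simp add: PY_def tensor_diff_right reindex_diff)
      show "trace_norm (?avg (center alpha (reindex swap_registers (beta \<otimes>\<^sub>t S)))) \<le> e * p"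
        using trace_norm_avg_center_le [OF a b mu(1) herm(2) S(3), where 'a = 'a and 'b = 'b] S(4)
        by (simp add: A mu(2) p_def)
    qed (use a b herm hermP in \<open>simp_all add: center_diff center_hermitian adj_tensor adj_reindex trace_norm_center_le\<close>)
    have b3: "trace_norm (?avg (center2 beta PX)) \<le> e * p + 2 * (eps * p)"
    proof (rule trace_norm_avg_le_of_approximation [where f = "center2 beta" and R = "alpha \<otimes>\<^sub>t T"])
      have d: "adj (rYM - T) = rYM - T"
        using herm by (simp add: adj_diff)
      show "trace_norm (PX - alpha \<otimes>\<^sub>t T) \<le> eps * p"
        using trace_norm_tensor_le [OF a d] T(2) by (simp add: PX_def tensor_diff_right)
      show "trace_norm (?avg (center2 beta (alpha \<otimes>\<^sub>t T))) \<le> e * p"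
        using trace_norm_avg_center2_le [OF a b mu(1) herm(3) T(3), where 'a = 'a and 'b = 'b] T(4)
        by (simp add: B mu(2) p_def)
    qed (use a b herm hermP in \<open>simp_all add: center2_diff center2_hermitian adj_tensor trace_norm_center2_le\<close>)
    have h: "adj (?avg (center alpha (center2 beta rho))) = ?avg (center alpha (center2 beta rho))"
      "adj (?avg (center alpha PY)) = ?avg (center alpha PY)"
      "adj (?avg (center2 beta PX)) = ?avg (center2 beta PX)"
      using a b herm hermP by (simp_all add: avg_placed_hermitian center_hermitian center2_hermitian)
    have "trace_norm (sigma - tau) \<le> trace_norm (?avg (center alpha (center2 beta rho)))
        + trace_norm (?avg (center alpha PY)) + trace_norm (?avg (center2 beta PX))"
      unfolding split using trace_norm_add [OF h(1,2)]
        trace_norm_add [of "?avg (center alpha (center2 beta rho)) + ?avg (center alpha PY)", OF _ h(3)] h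
      by (simp add: adj_add)
    also have "\<dots> \<le> 3 * (e * p) + 8 * (eps * p)"
      using b1 b2 b3 by linarith
    also have "\<dots> = (3 * e + 8 * eps) * p"
      by (simp add: algebra_simps)
    also have "\<dots> < (10 * e) * p"
    proof (rule mult_strict_right_mono [OF _ \<open>0 < p\<close>])
      \<comment> \<open>From \<open>eps <= e / 5\<close> the total is at most
        \<open>(3 + 8 / 5) * e\<close>, below \<open>10 * e\<close>.\<close>
      have "eps = e powr 64"
        using eps by (simp add: e_def powr_powr)
      also have "\<dots> \<le> e powr 2"
        using True \<open>0 < e\<close> by (intro powr_mono') auto
      also have "\<dots> = e * e"
        using \<open>0 < e\<close> by (simp add: powr_numeral power2_eq_square)
      also have "\<dots> \<le> e * (1 / 5)"
        using True \<open>0 < e\<close> by (intro mult_left_mono) auto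
      finally show "3 * e + 8 * eps < 10 * e"
        using \<open>0 < e\<close> by simp
    qed
    finally show ?thesis
      by (simp add: e_def p_def)
  qed
qed

end
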